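(* Let $N$ be a finite set with $|N|\geq 3$. Let $\theta\in\mathbb{R}^{\mathcal{P}(N)}$ be a coefficient vector with $\sum_{S\subseteq N}\theta(S)=0$ and $\sum_{L:\,\emptyset\neq L\subset N}\theta(L)=-1$. Then the inequality $0\leq\langle\theta,m\rangle$ is facet-defining for the cone $\mathcal{E}(N)$ of exact games if and only if $\theta=\theta_{\mathcal{S}}$ for some indecomposable min-semi-balanced system $\mathcal{S}$ on $N$.
   Context: $N$ is a finite set, $\mathcal{P}(N)$ is its power set, and $\subset$ denotes strict inclusion. For $S\subseteq N$, $\chi_S\in\mathbb{R}^N$ is the incidence vector of $S$. A constant vector in $\mathbb{R}^N$ is a vector $[r,\ldots,r]$ with $r\in\mathbb{R}$. A linear combination with real coefficients is affine if its coefficients sum to $1$, conic if all coefficients are $\geq 0$, and semi-conic if at most one coefficient is strictly negative. Set systems. A non-trivial set system on $N$ is a system $\mathcal{S}$ with $\emptyset\neq\mathcal{S}\subseteq\mathcal{P}(N)\setminus\{\emptyset,N\}$. It is balanced (on $N$) if $\chi_N$ is a conic combination of $\{\chi_S: S\in\mathcal{S}\}$ with all coefficients non-zero. It is semi-balanced (on $N$) if some constant vector in $\mathbb{R}^N$ is a semi-conic combination of $\{\chi_S: S\in\mathcal{S}\}$ with all coefficients non-zero. It is min-semi-balanced if it is semi-balanced and no semi-balanced $\mathcal{C}\subset\mathcal{S}$ exists. It is purely min-semi-balanced if it is min-semi-balanced and not balanced. A set $T\in\mathcal{S}$ is exceptional within a non-trivial set system $\mathcal{S}$ if there is a linear combination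 $\sum_{S\in\mathcal{S}}\lambda_S\chi_S$ yielding a constant vector in $\mathbb{R}^N$ with $\lambda_T<0$ and $\lambda_S\geq 0$ for $S\in\mathcal{S}\setminus\{T\}$. A purely min-semi-balanced system $\mathcal{S}$ has a decomposition if there is $E\subseteq N$, $E\notin\mathcal{S}\cup\{\emptyset,N\}$, such that $E$ is exceptional within $\mathcal{S}\cup\{E\}$. An indecomposable min-semi-balanced system is a purely min-semi-balanced system having no decomposition. Coefficient vectors. For a min-semi-balanced $\mathcal{S}$ there is a unique affine semi-conic combination $\sum_{S\in\mathcal{S}}\lambda_S\chi_S$ yielding a constant vector $[r,\ldots,r]$. The vector $\theta_{\mathcal{S}}\in\mathbb{R}^{\mathcal{P}(N)}$ is defined by $\theta_{\mathcal{S}}(S)=-\lambda_S$ for $S\in\mathcal{S}$, $\theta_{\mathcal{S}}(N)=r$, $\theta_{\mathcal{S}}(\emptyset)=1-r$, and $\theta_{\mathcal{S}}(L)=0$ for other $L\subseteq N$. Games. A game over $N$ is $m\in\mathbb{R}^{\mathcal{P}(N)}$ with $m(\emptyset)=0$. Its core is $C(m)=\{x\in\mathbb{R}^N:\sum_{i\in N}x_i=m(N),\ \sum_{i\in S}x_i\geq m(S)\ \forall S\subseteq N\}$. The game $m$ is exact if for each $S\subseteq N$ there is $x\in C(m)$ with $\sum_{i\in S}x_i=m(S)$. The set $\mathcal{E}(N)$ of exact games over $N$ is a polyhedral cone, full-dimensional when regarded in $\mathbb{R}^{\mathcal{P}(N)\setminus\{\emptyset\}}$. Write $\langle\theta,m\rangle=\sum_{S\subseteq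 N}\theta(S)m(S)$. The inequality $0\leq\langle\theta,m\rangle$ is facet-defining for $\mathcal{E}(N)$ if it is valid for all $m\in\mathcal{E}(N)$ and $\{m\in\mathcal{E}(N):\langle\theta,m\rangle=0\}$ is a facet, i.e. a face of dimension $\dim\mathcal{E}(N)-1$. *)

theory Defs
  imports "HOL-Analysis.Analysis"
begin

text \<open>
  The finite ground set N is the universe of a finite type \<open>'n\<close>; thus \<open>real ^ 'n\<close> is the space
  of real vectors indexed by N, and \<open>real ^ ('n set)\<close> the space of real vectors indexed by the
  power set of N.
\<close>

definition incidence :: "'n set \<Rightarrow> real ^ 'n::finite" where
  "incidence S = (\<chi> i. if i \<in> S then 1 else 0)"

definition lin_comb :: "'n set set \<Rightarrow> ('n set \<Rightarrow> real) \<Rightarrow> real ^ 'n::finite" where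
  "lin_comb \<S> l = (\<Sum>S\<in>\<S>. l S *\<^sub>R incidence S)"

definition constant_vector :: "real ^ 'n::finite \<Rightarrow> bool" where
  "constant_vector x \<longleftrightarrow> (\<exists>r. x = vec r)"

definition affine_coeffs :: "'n::finite set set \<Rightarrow> ('n set \<Rightarrow> real) \<Rightarrow> bool" where
  "affine_coeffs \<S> l \<longleftrightarrow> (\<Sum>S\<in>\<S>. l S) = 1"

definition conic_coeffs :: "'n::finite set set \<Rightarrow> ('n set \<Rightarrow> real) \<Rightarrow> bool" where
  "conic_coeffs \<S> l \<longleftrightarrow> (\<forall>S\<in>\<S>. l S \<ge> 0)"

definition semi_conic_coeffs :: "'n::finite set set \<Rightarrow> ('n set \<Rightarrow> real) \<Rightarrow> bool" where
  "semi_conic_coeffs \<S> l \<longleftrightarrow> card {S \<in> \<S>. l S < 0} \<le> 1"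

definition nontrivial_system :: "'n::finite set set \<Rightarrow> bool" where
  "nontrivial_system \<S> \<longleftrightarrow> \<S> \<noteq> {} \<and> \<S> \<subseteq> Pow UNIV - {{}, UNIV}"

definition balanced_system :: "'n::finite set set \<Rightarrow> bool" where
  "balanced_system \<S> \<longleftrightarrow> nontrivial_system \<S> \<and>
     (\<exists>l. conic_coeffs \<S> l \<and> (\<forall>S\<in>\<S>. l S \<noteq> 0) \<and> lin_comb \<S> l = incidence UNIV)"

definition semi_balanced :: "'n::finite set set \<Rightarrow> bool" where
  "semi_balanced \<S> \<longleftrightarrow> nontrivial_system \<S> \<and>
     (\<exists>l. semi_conic_coeffs \<S> l \<and> (\<forall>S\<in>\<S>. l S \<noteq> 0) \<and> constant_vector (lin_comb \<S> l))"

definition min_semi_balanced :: "'n::finite set set \<Rightarrow> bool" where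
  "min_semi_balanced \<S> \<longleftrightarrow> semi_balanced \<S> \<and> (\<nexists>\<C>. \<C> \<subset> \<S> \<and> semi_balanced \<C>)"

definition purely_min_semi_balanced :: "'n::finite set set \<Rightarrow> bool" where
  "purely_min_semi_balanced \<S> \<longleftrightarrow> min_semi_balanced \<S> \<and> \<not> balanced_system \<S>"

definition exceptional :: "'n::finite set \<Rightarrow> 'n set set \<Rightarrow> bool" where
  "exceptional T \<S> \<longleftrightarrow> nontrivial_system \<S> \<and> T \<in> \<S> \<and>
     (\<exists>l. constant_vector (lin_comb \<S> l) \<and> l T < 0 \<and> (\<forall>S\<in>\<S> - {T}. l S \<ge> 0))"

definition has_decomposition :: "'n::finite set set \<Rightarrow> bool" where
  "has_decomposition \<S> \<longleftrightarrow> (\<exists>E. E \<notin> \<S> \<union> {{}, UNIV} \<and> exceptional E (\<S> \<union> {E}))"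

definition indecomposable_min_semi_balanced :: "'n::finite set set \<Rightarrow> bool" where
  "indecomposable_min_semi_balanced \<S> \<longleftrightarrow>
     purely_min_semi_balanced \<S> \<and> \<not> has_decomposition \<S>"

text \<open>
  The coefficients of the affine semi-conic combination yielding a constant vector; they are
  unique when the system is min-semi-balanced. Only the values on the system matter, so the
  function is normalized to be zero elsewhere to make the description definite.
\<close>

definition msb_coeffs :: "'n::finite set set \<Rightarrow> 'n set \<Rightarrow> real" where
  "msb_coeffs \<S> = (THE l. (\<forall>S. S \<notin> \<S> \<longrightarrow> l S = 0) \<and>
     affine_coeffs \<S> l \<and> semi_conic_coeffs \<S> l \<and> constant_vector (lin_comb \<S> l))"

definition msb_constant :: "'n::finite set set \<Rightarrow> real" where
  "msb_constant \<S> = (THE r. lin_comb \<S> (msb_coeffs \<S>) = vec r)"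

definition theta_vector :: "'n::finite set set \<Rightarrow> real ^ ('n set)" where
  "theta_vector \<S> = (\<chi> L.
     if L \<in> \<S> then - msb_coeffs \<S> L
     else if L = UNIV then msb_constant \<S>
     else if L = {} then 1 - msb_constant \<S>
     else 0)"

definition is_game :: "real ^ ('n::finite set) \<Rightarrow> bool" where
  "is_game m \<longleftrightarrow> m $ {} = 0"

definition game_core :: "real ^ ('n::finite set) \<Rightarrow> (real ^ 'n) set" where
  "game_core m = {x. (\<Sum>i\<in>UNIV. x $ i) = m $ UNIV \<and> (\<forall>S. (\<Sum>i\<in>S. x $ i) \<ge> m $ S)}"

definition exact_game :: "real ^ ('n::finite set) \<Rightarrow> bool" where
  "exact_game m \<longleftrightarrow> is_game m \<and> (\<forall>S. \<exists>x\<in>game_core m. (\<Sum>i\<in>S. x $ i) = m $ S)"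

definition exact_cone :: "(real ^ ('n::finite set)) set" where
  "exact_cone = {m. exact_game m}"

definition facet_defining :: "'a::euclidean_space \<Rightarrow> 'a set \<Rightarrow> bool" where
  "facet_defining \<theta> K \<longleftrightarrow>
     (\<forall>m\<in>K. 0 \<le> \<theta> \<bullet> m) \<and> {m \<in> K. \<theta> \<bullet> m = 0} facet_of K"

end

theory Submission
  imports Defs
begin

text \<open>
  By linear programming duality, a game is exact iff it has nonnegative product with each vector
  of the cones \<open>exceptional_cone D\<close>: these consist of the vectors that annihilate all modular
  games and are nonpositive at every nontrivial set other than \<open>D\<close>. The vectors of minimal
  support in these cones are the positive multiples of the vectors \<open>theta_vector \<S>\<close> of min-semi-balanced
  systems, so finitely many of the latter define the cone of exact games, and its facets
  correspond to those that span extreme rays of the dual cone.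

  If \<open>\<S>\<close> has a decomposition or is balanced, then an explicit splitting of \<open>theta_vector \<S>\<close>
  shows that the ray is not extreme; for balanced systems it uses the relation
  between \<open>A\<close>, \<open>C\<close>, \<open>A \<inter> C\<close> and \<open>A \<union> C\<close> with one of the last two trivial. Conversely, given a
  representation of \<open>theta_vector \<S>\<close> as a sum of vectors of the cones \<open>exceptional_cone D\<close>, the
  sets \<open>D\<close> outside \<open>\<S>\<close> can be eliminated one by one unless \<open>\<S>\<close> has a decomposition; then all
  summands are supported on \<open>\<S>\<close>, hence multiples of \<open>theta_vector \<S>\<close> by minimality.
\<close>

section \<open>Farkas duality for finitely generated cones\<close>

text \<open>Farkas' lemma by strict separation: the generated cone is closed, and it contains
  \<open>0\<close>, so the separating level \<open>b\<close> is negative.\<close>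

lemma in_convex_cone_hull_if_dual:
  fixes G :: "'a::euclidean_space set"
  assumes "finite G" and dual: "\<And>a. (\<And>g. g \<in> G \<Longrightarrow> 0 \<le> a \<bullet> g) \<Longrightarrow> 0 \<le> a \<bullet> z"
  shows "z \<in> convex_cone hull G"
proof (rule ccontr)
  assume "z \<notin> convex_cone hull G"
  then obtain a b where az: "a \<bullet> z < b" and ab: "\<And>x. x \<in> convex_cone hull G \<Longrightarrow> b < a \<bullet> x"
    using separating_hyperplane_closed_point[of "convex_cone hull G" z]
      closed_convex_cone_hull[OF assms(1)] convex_convex_cone_hull by blast
  have b: "b < 0"
    using ab[OF convex_cone_hull_contains_0] by simp
  have "0 \<le> a \<bullet> g" if "g \<in> G" for g
  proof (rule ccontr)
    assume n: "\<not> 0 \<le> a \<bullet> g"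
    \<comment> \<open>This nonnegative multiple of \<open>g\<close> has product exactly
      \<open>b\<close> with \<open>a\<close>, against strict separation.\<close>
    have "(b / (a \<bullet> g)) *\<^sub>R g \<in> convex_cone hull G"
      using n b that by (intro convex_cone_hull_mul hull_inc divide_nonpos_nonpos) auto
    from ab[OF this] n show False by simp
  qed
  then have "0 \<le> a \<bullet> z" by (rule dual)
  with az b show False by simp
qed

section \<open>Modular games, their annihilators and exceptional cones\<close>

definition modular_game :: "real ^ 'n \<Rightarrow> real ^ ('n::finite set)" where
  "modular_game x = (\<chi> S. \<Sum>i\<in>S. x $ i)"

text \<open>Annihilating modular games leaves the entry at \<open>{}\<close> free, and games do not
  see it; the product with the all-one vector \<open>1\<close> fixes it.\<close>

definition annihilators :: "(real ^ ('n::finite set)) set" where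
  "annihilators = {\<theta>. \<theta> \<bullet> 1 = 0 \<and> (\<forall>x. \<theta> \<bullet> modular_game x = 0)}"

text \<open>Dual to the existence of a core element that is tight at \<open>D\<close>. A trivial
  \<open>D\<close> exempts no further set and gives the cone that governs nonemptiness of the
  core.\<close>

definition exceptional_cone :: "'n set \<Rightarrow> (real ^ ('n::finite set)) set" where
  "exceptional_cone D = {\<theta> \<in> annihilators. \<forall>S. S \<notin> {{}, UNIV, D} \<longrightarrow> \<theta> $ S \<le> 0}"

definition supp :: "real ^ ('n::finite set) \<Rightarrow> 'n set set" where
  "supp \<theta> = {S. S \<noteq> {} \<and> S \<noteq> UNIV \<and> \<theta> $ S \<noteq> 0}"

text \<open>
  Its product with a vector is minus the sum of the entries at the nontrivial sets, so the
  hypothesis of the theorem normalizes \<open>\<theta>\<close> to have product 1 with this game.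
\<close>
definition unit_game :: "real ^ ('n::finite set)" where
  "unit_game = (\<chi> S. if S = {} \<or> S = UNIV then 0 else -1)"

lemma modular_game_eq_sum_axis:
  "modular_game x = (\<Sum>i\<in>UNIV. (x $ i) *\<^sub>R modular_game (axis i 1))"
  by (simp add: modular_game_def vec_eq_iff axis_def if_distrib sum.If_cases sum.delta cong: if_cong)

lemma inner_eq_sum_supp:
  fixes \<theta> m :: "real ^ ('n::finite set)"
  assumes "supp \<theta> \<subseteq> \<S>" "{} \<notin> \<S>" "UNIV \<notin> \<S>"
  shows "\<theta> \<bullet> m = (\<Sum>S\<in>\<S>. \<theta> $ S * m $ S) + \<theta> $ UNIV * m $ UNIV + \<theta> $ {} * m $ {}"
proof -
  have "\<theta> \<bullet> m = (\<Sum>S\<in>\<S> \<union> {UNIV, {}}. \<theta> $ S * m $ S)"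
    unfolding inner_vec_def inner_real_def using assms(1)
    by (intro sum.mono_neutral_right) (auto simp: supp_def)
  also have "\<dots> = (\<Sum>S\<in>\<S>. \<theta> $ S * m $ S) + (\<Sum>S\<in>{UNIV, {}}. \<theta> $ S * m $ S)"
    using assms(2,3) by (intro sum.union_disjoint) auto
  finally show ?thesis by simp
qed

lemma annihilatorsD:
  "\<theta> \<in> annihilators \<Longrightarrow> \<theta> \<bullet> 1 = 0" "\<theta> \<in> annihilators \<Longrightarrow> \<theta> \<bullet> modular_game x = 0"
  by (auto simp: annihilators_def)

lemma subspace_annihilators: "subspace annihilators"
  by (auto simp: subspace_def annihilators_def inner_add_left)

text \<open>A modular game of total 1 isolates the entry at \<open>UNIV\<close>; the product with
  \<open>1\<close> then leaves only the entry at \<open>{}\<close>.\<close>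

lemma annihilator_eq_0:
  assumes "\<theta> \<in> annihilators" "supp \<theta> = {}"
  shows "\<theta> = 0"
proof -
  have z: "\<theta> $ S = 0" if "S \<noteq> {}" "S \<noteq> UNIV" for S
    using assms(2) that by (auto simp: supp_def)
  have e: "\<theta> \<bullet> m = \<theta> $ UNIV * m $ UNIV + \<theta> $ {} * m $ {}" for m
    using inner_eq_sum_supp[of \<theta> "{}" m] assms(2) by simp
  have "\<theta> $ UNIV = 0"
    using annihilatorsD(2)[OF assms(1), of "axis undefined 1"] unfolding e
    by (simp add: modular_game_def axis_def)
  moreover have "\<theta> $ {} = 0"
    using annihilatorsD(1)[OF assms(1)] calculation unfolding e by simp
  ultimately show ?thesis
    using z by (metis vec_eq_iff zero_index)
qed

lemma unit_game_inner:
  assumes "supp \<theta> \<subseteq> \<S>" "{} \<notin> \<S>" "UNIV \<notin> \<S>"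
  shows "\<theta> \<bullet> unit_game = - (\<Sum>S\<in>\<S>. \<theta> $ S)"
proof -
  have "(\<Sum>S\<in>\<S>. \<theta> $ S * unit_game $ S) = (\<Sum>S\<in>\<S>. - \<theta> $ S)"
    using assms by (intro sum.cong) (auto simp: unit_game_def)
  then show ?thesis
    unfolding inner_eq_sum_supp[OF assms] by (simp add: unit_game_def sum_negf)
qed

text \<open>Equality is confined to \<open>D\<close> and the trivial sets. This gives
  \<open>unit_game\<close> strictly positive product with the nonzero vectors of
  \<open>exceptional_cone D\<close>.\<close>

lemma unit_game_strict_selector:
  fixes D :: "'n::finite set"
  obtains x where "(\<Sum>i\<in>UNIV. x $ i) = 0" "unit_game $ D = (\<Sum>i\<in>D. x $ i)"
    "\<And>S. S \<notin> {{}, UNIV, D} \<Longrightarrow> unit_game $ S < (\<Sum>i\<in>S. x $ i)"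
proof (cases "D = {} \<or> D = UNIV")
  case True
  show ?thesis by (rule that[of 0]) (use True in \<open>auto simp: unit_game_def\<close>)
next
  case False
  \<comment> \<open>A total of -1 is spread evenly over \<open>D\<close> and a total of 1 over its
    complement. A nontrivial set other than \<open>D\<close> either contains \<open>D\<close> and a
    further point or misses a point of \<open>D\<close>; its sum exceeds -1 in both cases.\<close>
  define x :: "real ^ 'n" where
    "x = (\<chi> i. if i \<in> D then - 1 / real (card D) else 1 / real (card (- D)))"
  have pos: "card D > 0" "card (- D) > 0"
    using False by (auto simp: card_gt_0_iff)
  have sum: "(\<Sum>i\<in>S. x $ i) = real (card (S - D)) / card (- D) - real (card (S \<inter> D)) / card D" for S
  proof -
    have "(\<Sum>i\<in>S. x $ i) = (\<Sum>i\<in>S \<inter> D. x $ i) + (\<Sum>i\<in>S - D. x $ i)"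
      by (subst sum.union_disjoint[symmetric]) (auto intro: sum.cong)
    also have "(\<Sum>i\<in>S \<inter> D. x $ i) = (\<Sum>i\<in>S \<inter> D. - 1 / real (card D))"
      by (intro sum.cong) (auto simp: x_def)
    also have "(\<Sum>i\<in>S - D. x $ i) = (\<Sum>i\<in>S - D. 1 / real (card (- D)))"
      by (intro sum.cong) (auto simp: x_def)
    finally show ?thesis by simp
  qed
  show ?thesis
  proof (rule that[of x])
    show "(\<Sum>i\<in>UNIV. x $ i) = 0"
      using pos by (auto simp: sum Compl_eq_Diff_UNIV[symmetric])
    show "unit_game $ D = (\<Sum>i\<in>D. x $ i)"
      using pos False by (simp add: sum unit_game_def)
    fix S assume S: "S \<notin> {{}, UNIV, D}"
    have le: "card (S \<inter> D) \<le> card D"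
      by (intro card_mono) auto
    show "unit_game $ S < (\<Sum>i\<in>S. x $ i)"
    proof (cases "D \<subseteq> S")
      case sub: True
      then have "card (S - D) > 0" using S by (auto simp: card_gt_0_iff)
      then have "real (card (S - D)) / card (- D) > 0" using pos by simp
      moreover have "S \<inter> D = D" using sub by auto
      ultimately show ?thesis using S pos False unfolding sum by (simp add: unit_game_def)
    next
      case nsub: False
      then have "card (S \<inter> D) < card D" by (intro psubset_card_mono) auto
      then have "real (card (S \<inter> D)) / card D < 1" using pos by simp
      moreover have "real (card (S - D)) / card (- D) \<ge> 0" by simp
      moreover have "unit_game $ S = -1" using S by (simp add: unit_game_def)
      ultimately show ?thesis unfolding sum by linarith
    qed
  qed
qed

text \<open>Subtracting the modular game of \<open>x\<close> does not change the product, and makes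
  the entries at \<open>{}\<close>, \<open>UNIV\<close> and \<open>D\<close> vanish.\<close>

lemma exceptional_cone_inner_selector:
  assumes "\<theta> \<in> exceptional_cone D" and m: "m $ {} = 0"
    and x: "(\<Sum>i\<in>UNIV. x $ i) = m $ UNIV" "m $ D = (\<Sum>i\<in>D. x $ i)"
  shows "\<theta> \<bullet> m = (\<Sum>S | S \<notin> {{}, UNIV, D}. \<theta> $ S * (m $ S - (\<Sum>i\<in>S. x $ i)))"
proof -
  have "\<theta> \<bullet> m = \<theta> \<bullet> (m - modular_game x)"
    using assms(1) by (simp add: exceptional_cone_def annihilatorsD inner_diff_right)
  also have "\<dots> = (\<Sum>S\<in>UNIV. \<theta> $ S * (m $ S - (\<Sum>i\<in>S. x $ i)))"
    by (simp add: inner_vec_def modular_game_def)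
  also have "\<dots> = (\<Sum>S | S \<notin> {{}, UNIV, D}. \<theta> $ S * (m $ S - (\<Sum>i\<in>S. x $ i)))"
    using m x by (intro sum.mono_neutral_right) auto
  finally show ?thesis .
qed

text \<open>Against a strict selector all terms are nonnegative, so the product could vanish only if
  the support were contained in \<open>{D}\<close>.\<close>

lemma exceptional_cone_pos:
  assumes \<theta>: "\<theta> \<in> exceptional_cone D" "\<theta> \<noteq> 0"
  shows "\<theta> \<bullet> unit_game > 0"
proof -
  obtain x where x: "(\<Sum>i\<in>UNIV. x $ i) = 0" "unit_game $ D = (\<Sum>i\<in>D. x $ i)"
    and lt: "\<And>S. S \<notin> {{}, UNIV, D} \<Longrightarrow> unit_game $ S < (\<Sum>i\<in>S. x $ i)"
    using unit_game_strict_selector[of D] by metis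
  have eq: "\<theta> \<bullet> unit_game = (\<Sum>S | S \<notin> {{}, UNIV, D}. \<theta> $ S * (unit_game $ S - (\<Sum>i\<in>S. x $ i)))"
    by (rule exceptional_cone_inner_selector[OF \<theta>(1)]) (use x in \<open>simp_all add: unit_game_def\<close>)
  have nn: "0 \<le> \<theta> $ S * (unit_game $ S - (\<Sum>i\<in>S. x $ i))" if "S \<notin> {{}, UNIV, D}" for S
    using \<theta>(1) that lt[OF that] by (auto simp: exceptional_cone_def intro!: mult_nonpos_nonpos)
  have "\<exists>S. S \<notin> {{}, UNIV, D} \<and> \<theta> $ S \<noteq> 0"
  proof (rule ccontr)
    assume *: "\<nexists>S. S \<notin> {{}, UNIV, D} \<and> \<theta> $ S \<noteq> 0"
    have ann: "\<theta> \<in> annihilators" using \<theta>(1) by (simp add: exceptional_cone_def)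
    have D: "D \<noteq> {}" "D \<noteq> UNIV" "\<theta> $ D \<noteq> 0"
      using * annihilator_eq_0[OF ann] \<theta>(2) by (auto simp: supp_def)
    have *: "supp \<theta> \<subseteq> {D}" using * by (auto simp: supp_def)
    \<comment> \<open>The incidence vector of \<open>D\<close> is not constant: comparing a point of
      \<open>D\<close> with a point outside forces \<open>\<theta> $ D = 0\<close>.\<close>
    obtain i j where ij: "i \<in> D" "j \<notin> D" using D by auto
    have "\<theta> $ D * modular_game (axis k 1) $ D + \<theta> $ UNIV * modular_game (axis k 1) $ UNIV = 0" for k
      using annihilatorsD(2)[OF ann, of "axis k 1"] inner_eq_sum_supp[OF *, of "modular_game (axis k 1)"] D
      by (simp add: modular_game_def)
    from this[of i] this[of j] ij D(3) show False
      by (simp add: modular_game_def axis_def)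
  qed
  then obtain S where S: "S \<notin> {{}, UNIV, D}" "\<theta> $ S \<noteq> 0" by blast
  have "0 < \<theta> $ S * (unit_game $ S - (\<Sum>i\<in>S. x $ i))"
    using nn[OF S(1)] S(2) lt[OF S(1)] by (simp add: less_le)
  then show ?thesis
    unfolding eq using S nn by (intro sum_pos2[where i=S]) auto
qed

text \<open>A core element tight at \<open>D\<close> makes every term of the product nonnegative.
  Conversely, its existence follows from membership of \<open>m\<close> in a finitely generated
  cone, to which Farkas' lemma applies.\<close>

lemma exact_game_iff:
  fixes m :: "real ^ ('n::finite set)"
  shows "exact_game m \<longleftrightarrow> m $ {} = 0 \<and> (\<forall>D. \<forall>\<theta>\<in>exceptional_cone D. 0 \<le> \<theta> \<bullet> m)"
proof safe
  assume ex: "exact_game m"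
  then show m0: "m $ {} = 0" by (simp add: exact_game_def is_game_def)
  fix D and \<theta> :: "real ^ ('n set)" assume \<theta>: "\<theta> \<in> exceptional_cone D"
  obtain x where x: "x \<in> game_core m" "(\<Sum>i\<in>D. x $ i) = m $ D"
    using ex by (auto simp: exact_game_def)
  have "\<theta> \<bullet> m = (\<Sum>S | S \<notin> {{}, UNIV, D}. \<theta> $ S * (m $ S - (\<Sum>i\<in>S. x $ i)))"
    using exceptional_cone_inner_selector[OF \<theta> m0, of x] x by (simp add: game_core_def)
  also have "\<dots> \<ge> 0"
    using x \<theta> by (intro sum_nonneg mult_nonpos_nonpos) (auto simp: game_core_def exceptional_cone_def)
  finally show "0 \<le> \<theta> \<bullet> m" .
next
  assume m0: "m $ {} = 0" and dual: "\<forall>D. \<forall>\<theta>\<in>exceptional_cone D. 0 \<le> \<theta> \<bullet> m"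
  have "\<exists>x\<in>game_core m. (\<Sum>i\<in>D. x $ i) = m $ D" for D
  proof -
    \<comment> \<open>Membership of \<open>m\<close> in \<open>Q\<close> means that the core of
      \<open>m\<close> has an element tight at \<open>D\<close>; the cone generated by
      \<open>G\<close> lies inside \<open>Q\<close>.\<close>
    define Q where "Q = {y::real ^ ('n set). \<exists>x. (\<forall>S. y $ S \<le> (\<Sum>i\<in>S. x $ i)) \<and>
      (\<forall>S\<in>{{}, UNIV, D}. y $ S = (\<Sum>i\<in>S. x $ i))}"
    define G :: "(real ^ ('n set)) set" where
      "G = range (\<lambda>i. modular_game (axis i 1)) \<union> range (\<lambda>i. - modular_game (axis i 1)) \<union>
        (\<lambda>S. - axis S 1) ` (- {{}, UNIV, D})"
    have cone: "convex_cone Q"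
      unfolding convex_cone_iff
    proof (intro conjI allI impI ballI)
      show "0 \<in> Q" unfolding Q_def by (auto intro!: exI[of _ 0])
    next
      fix a b assume "a \<in> Q" "b \<in> Q"
      then obtain x y where
        "\<forall>S. a $ S \<le> (\<Sum>i\<in>S. x $ i)" "\<forall>S\<in>{{}, UNIV, D}. a $ S = (\<Sum>i\<in>S. x $ i)"
        "\<forall>S. b $ S \<le> (\<Sum>i\<in>S. y $ i)" "\<forall>S\<in>{{}, UNIV, D}. b $ S = (\<Sum>i\<in>S. y $ i)"
        unfolding Q_def by blast
      then show "a + b \<in> Q" unfolding Q_def
        by (auto simp: sum.distrib intro!: exI[of _ "x + y"] add_mono)
    next
      fix a and c :: real assume "a \<in> Q" "0 \<le> c"
      then obtain x where "0 \<le> c"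
        "\<forall>S. a $ S \<le> (\<Sum>i\<in>S. x $ i)" "\<forall>S\<in>{{}, UNIV, D}. a $ S = (\<Sum>i\<in>S. x $ i)"
        unfolding Q_def by blast
      then show "c *\<^sub>R a \<in> Q" unfolding Q_def
        by (auto simp: sum_distrib_left[symmetric] mult_left_mono intro!: exI[of _ "c *\<^sub>R x"])
    qed
    have "G \<subseteq> Q"
    proof
      fix g assume "g \<in> G"
      then consider i where "g = modular_game (axis i 1)" | i where "g = - modular_game (axis i 1)"
        | S where "S \<notin> {{}, UNIV, D}" "g = - axis S 1" unfolding G_def by blast
      then show "g \<in> Q"
      proof cases
        case (1 i) then show ?thesis unfolding Q_def
          by (auto simp: modular_game_def intro!: exI[of _ "axis i 1"])
      next
        case (2 i) then show ?thesis unfolding Q_def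
          by (auto simp: modular_game_def sum_negf intro!: exI[of _ "- axis i 1"])
      next
        case 3 then show ?thesis unfolding Q_def
          by (auto simp: axis_def intro!: exI[of _ 0])
      qed
    qed
    then have hull: "convex_cone hull G \<subseteq> Q"
      using cone by (rule hull_minimal)
    have "m \<in> convex_cone hull G"
    proof (rule in_convex_cone_hull_if_dual)
      fix a assume a: "\<And>g. g \<in> G \<Longrightarrow> 0 \<le> a \<bullet> g"
      \<comment> \<open>Correcting the entry at \<open>{}\<close> makes the product with
        \<open>1\<close> vanish and preserves the products with \<open>m\<close> and with modular
        games, which are zero at \<open>{}\<close>.\<close>
      define \<theta> where "\<theta> = a - axis {} (a \<bullet> 1)"
      have mod: "a \<bullet> modular_game (axis i 1) = 0" for i
        using a[of "modular_game (axis i 1)"] a[of "- modular_game (axis i 1)"]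
        by (force simp: G_def)
      have "\<theta> \<bullet> modular_game x = 0" for x
      proof -
        have "a \<bullet> modular_game x = 0"
          by (subst modular_game_eq_sum_axis) (simp add: inner_sum_right mod)
        then show ?thesis
          by (simp add: \<theta>_def inner_diff_left inner_axis') (simp add: modular_game_def)
      qed
      moreover have "\<theta> \<bullet> 1 = 0"
        by (simp add: \<theta>_def inner_diff_left inner_axis')
      moreover have "\<theta> $ S \<le> 0" if "S \<notin> {{}, UNIV, D}" for S
      proof -
        have "- axis S 1 \<in> G" using that unfolding G_def by blast
        from a[OF this] have "a $ S \<le> 0" by (simp add: inner_axis)
        then show ?thesis using that by (simp add: \<theta>_def axis_def)
      qed
      ultimately have "\<theta> \<in> exceptional_cone D"
        by (simp add: exceptional_cone_def annihilators_def)
      then have "0 \<le> \<theta> \<bullet> m" using dual by blast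
      then show "0 \<le> a \<bullet> m"
        using m0 by (simp add: \<theta>_def inner_diff_left inner_axis')
    qed (simp add: G_def)
    with hull obtain x where "\<forall>S. m $ S \<le> (\<Sum>i\<in>S. x $ i)"
      "\<forall>S\<in>{{}, UNIV, D}. m $ S = (\<Sum>i\<in>S. x $ i)" unfolding Q_def by blast
    then show ?thesis
      by (intro bexI[of _ x]) (auto simp: game_core_def)
  qed
  then show "exact_game m" using m0 by (auto simp: exact_game_def is_game_def)
qed

section \<open>Operations on exceptional cones and the ratio test\<close>

lemma exceptional_cone_add:
  "\<theta> \<in> exceptional_cone D \<Longrightarrow> \<theta>' \<in> exceptional_cone D \<Longrightarrow> \<theta> + \<theta>' \<in> exceptional_cone D"
  by (auto simp: exceptional_cone_def intro: subspace_add[OF subspace_annihilators] add_nonpos_nonpos)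

lemma exceptional_cone_scaleR:
  "\<theta> \<in> exceptional_cone D \<Longrightarrow> 0 \<le> c \<Longrightarrow> c *\<^sub>R \<theta> \<in> exceptional_cone D"
  by (auto simp: exceptional_cone_def mult_nonneg_nonpos
      intro: subspace_scale[OF subspace_annihilators])

lemma exceptional_cone_0 [simp]: "0 \<in> exceptional_cone D"
  by (simp add: exceptional_cone_def subspace_0[OF subspace_annihilators])

lemma exceptional_cone_sum:
  "(\<And>a. a \<in> A \<Longrightarrow> f a \<in> exceptional_cone D) \<Longrightarrow> (\<Sum>a\<in>A. f a) \<in> exceptional_cone D"
  by (induction A rule: infinite_finite_induct) (auto intro: exceptional_cone_add)

lemma exceptional_cone_annihilators: "\<theta> \<in> exceptional_cone D \<Longrightarrow> \<theta> \<in> annihilators"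
  by (simp add: exceptional_cone_def)

lemma exceptional_cone_nonpos:
  "\<theta> \<in> exceptional_cone D \<Longrightarrow> S \<notin> {{}, UNIV, D} \<Longrightarrow> \<theta> $ S \<le> 0"
  by (auto simp: exceptional_cone_def)

lemma exceptional_cone_empty_subset: "\<theta> \<in> exceptional_cone {} \<Longrightarrow> \<theta> \<in> exceptional_cone D"
  by (auto simp: exceptional_cone_def)

lemma exceptional_cone_inner_nonneg: "\<theta> \<in> exceptional_cone D \<Longrightarrow> 0 \<le> \<theta> \<bullet> unit_game"
  using exceptional_cone_pos[of \<theta> D] by (cases "\<theta> = 0") auto

text \<open>Ratio test: the largest multiple of \<open>\<theta>'\<close> whose subtraction respects
  the sign conditions brings some entry of \<open>\<theta>\<close> to zero. If
  \<open>supp \<theta>'\<close> lies in \<open>supp \<theta>\<close>, the support shrinks.\<close>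

lemma exceptional_cone_subtract:
  assumes \<theta>: "\<theta> \<in> exceptional_cone D" and \<theta>': "\<theta>' \<in> exceptional_cone D'" "\<theta>' \<noteq> 0"
    and neg: "\<And>S. S \<notin> {{}, UNIV, D} \<Longrightarrow> \<theta>' $ S < 0 \<Longrightarrow> \<theta> $ S \<noteq> 0"
  obtains t S where "0 < t" "S \<in> supp \<theta>" "\<theta> $ S = t * \<theta>' $ S"
    "\<theta> - t *\<^sub>R \<theta>' \<in> exceptional_cone D"
proof -
  define A where "A = {S. S \<notin> {{}, UNIV, D} \<and> \<theta>' $ S < 0}"
  \<comment> \<open>Otherwise \<open>- \<theta>'\<close> would lie in
    \<open>exceptional_cone D\<close>, and both \<open>\<theta>'\<close> and
    \<open>- \<theta>'\<close> would have positive product with \<open>unit_game\<close>.\<close>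
  have "A \<noteq> {}"
  proof
    assume "A = {}"
    then have "(- \<theta>') $ S \<le> 0" if "S \<notin> {{}, UNIV, D}" for S
    proof -
      have "S \<notin> A" using \<open>A = {}\<close> by blast
      then have "\<not> \<theta>' $ S < 0" using that unfolding A_def by blast
      then show ?thesis by simp
    qed
    moreover have "- \<theta>' \<in> annihilators"
      using \<theta>'(1) by (simp add: exceptional_cone_annihilators subspace_neg[OF subspace_annihilators])
    ultimately have "- \<theta>' \<in> exceptional_cone D"
      unfolding exceptional_cone_def by blast
    from exceptional_cone_pos[OF this] exceptional_cone_pos[OF \<theta>'] show False
      using \<theta>'(2) by simp
  qed
  define t where "t = Min ((\<lambda>S. \<theta> $ S / \<theta>' $ S) ` A)"
  have "t \<in> (\<lambda>S. \<theta> $ S / \<theta>' $ S) ` A"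
    unfolding t_def using \<open>A \<noteq> {}\<close> by (intro Min_in) auto
  then obtain S where S: "S \<in> A" "t = \<theta> $ S / \<theta>' $ S" by auto
  have min: "t \<le> \<theta> $ S / \<theta>' $ S" if "S \<in> A" for S
    unfolding t_def using that by (intro Min_le) auto
  have neg_\<theta>: "\<theta> $ S < 0" if "S \<in> A" for S
    using neg[of S] exceptional_cone_nonpos[OF \<theta>, of S] that by (auto simp: A_def less_le)
  show ?thesis
  proof (rule that[of t S])
    show "0 < t" "S \<in> supp \<theta>" "\<theta> $ S = t * \<theta>' $ S"
      using S neg_\<theta>[of S] by (auto simp: A_def supp_def divide_neg_neg)
    have "\<theta> $ R - t * \<theta>' $ R \<le> 0" if R: "R \<notin> {{}, UNIV, D}" for R
    proof (cases "R \<in> A")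
      case True
      then have "\<theta>' $ R < 0" by (simp add: A_def)
      then show ?thesis using min[OF True] by (simp add: le_divide_eq)
    next
      case False
      then have "0 \<le> t * \<theta>' $ R" using R \<open>0 < t\<close> by (simp add: A_def)
      then show ?thesis using exceptional_cone_nonpos[OF \<theta> R] by linarith
    qed
    then show "\<theta> - t *\<^sub>R \<theta>' \<in> exceptional_cone D"
      using \<theta> \<theta>' by (auto simp: exceptional_cone_def
          intro: subspace_diff[OF subspace_annihilators] subspace_scale[OF subspace_annihilators])
  qed
qed

section \<open>Semi-balanced systems as supports\<close>

text \<open>Extends the pattern of \<open>theta_vector\<close> to arbitrary coefficients and
  constants; for a nontrivial system the entry at \<open>{}\<close> makes the total zero.\<close>

definition relation_vector ::
    "'n set set \<Rightarrow> ('n set \<Rightarrow> real) \<Rightarrow> real \<Rightarrow> real ^ ('n::finite set)" where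
  "relation_vector \<S> l r = (\<chi> L. if L \<in> \<S> then - l L else if L = UNIV then r
     else if L = {} then (\<Sum>S\<in>\<S>. l S) - r else 0)"

lemma lin_comb_inner: "lin_comb \<S> l \<bullet> x = (\<Sum>S\<in>\<S>. l S * (\<Sum>i\<in>S. x $ i))"
proof -
  have "incidence S \<bullet> x = (\<Sum>i\<in>S. x $ i)" for S
    by (simp add: incidence_def inner_vec_def if_distrib[where f="\<lambda>a. a * _"] sum.If_cases cong: if_cong)
  then show ?thesis by (simp add: lin_comb_def inner_sum_left)
qed

lemma vec_inner: "vec r \<bullet> x = r * (\<Sum>i\<in>UNIV. x $ i)"
  by (simp add: inner_vec_def sum_distrib_left)

lemma relation_vector_facts:
  assumes "nontrivial_system \<S>"
  shows "supp (relation_vector \<S> l r) = {S \<in> \<S>. l S \<noteq> 0}"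
    and "relation_vector \<S> l r \<bullet> unit_game = (\<Sum>S\<in>\<S>. l S)"
    and "lin_comb \<S> l = vec r \<Longrightarrow> relation_vector \<S> l r \<in> annihilators"
proof -
  have nt: "{} \<notin> \<S>" "UNIV \<notin> \<S>" using assms by (auto simp: nontrivial_system_def)
  show s: "supp (relation_vector \<S> l r) = {S \<in> \<S>. l S \<noteq> 0}"
    using nt by (auto simp: supp_def relation_vector_def)
  then have s': "supp (relation_vector \<S> l r) \<subseteq> \<S>" by auto
  have "(\<Sum>S\<in>\<S>. relation_vector \<S> l r $ S) = (\<Sum>S\<in>\<S>. - l S)"
    by (intro sum.cong) (auto simp: relation_vector_def)
  then show "relation_vector \<S> l r \<bullet> unit_game = (\<Sum>S\<in>\<S>. l S)"
    unfolding unit_game_inner[OF s' nt] by (simp add: sum_negf)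
  assume "lin_comb \<S> l = vec r"
  then have l: "(\<Sum>S\<in>\<S>. l S * (\<Sum>i\<in>S. x $ i)) = r * (\<Sum>i\<in>UNIV. x $ i)" for x
    by (metis lin_comb_inner vec_inner)
  have e: "relation_vector \<S> l r \<bullet> m = - (\<Sum>S\<in>\<S>. l S * m $ S) + r * m $ UNIV
      + ((\<Sum>S\<in>\<S>. l S) - r) * m $ {}" for m
  proof -
    have "(\<Sum>S\<in>\<S>. relation_vector \<S> l r $ S * m $ S) = (\<Sum>S\<in>\<S>. - (l S * m $ S))"
      by (intro sum.cong) (auto simp: relation_vector_def)
    then show ?thesis
      unfolding inner_eq_sum_supp[OF s' nt] using nt by (simp add: sum_negf) (simp add: relation_vector_def nt)
  qed
  show "relation_vector \<S> l r \<in> annihilators"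
    using l by (simp add: annihilators_def e modular_game_def)
qed

lemma annihilator_lin_comb:
  assumes "\<theta> \<in> annihilators" "supp \<theta> \<subseteq> \<S>" "nontrivial_system \<S>"
  shows "lin_comb \<S> (\<lambda>S. - \<theta> $ S) = vec (\<theta> $ UNIV)"
proof -
  have nt: "{} \<notin> \<S>" "UNIV \<notin> \<S>" using assms by (auto simp: nontrivial_system_def)
  have "lin_comb \<S> (\<lambda>S. - \<theta> $ S) \<bullet> x = vec (\<theta> $ UNIV) \<bullet> x" for x
    using annihilatorsD(2)[OF assms(1), of x] unfolding inner_eq_sum_supp[OF assms(2) nt] lin_comb_inner vec_inner
    by (simp add: modular_game_def sum_negf)
  then show ?thesis using vector_eq_rdot by blast
qed

lemma nontrivial_system_supp:
  "\<theta> \<in> annihilators \<Longrightarrow> \<theta> \<noteq> 0 \<Longrightarrow> nontrivial_system (supp \<theta>)"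
  using annihilator_eq_0[of \<theta>] by (auto simp: nontrivial_system_def supp_def)

text \<open>The negated entries are the coefficients of a combination yielding a constant vector,
  and only the one at \<open>D\<close> can be negative. With \<open>semi_balancedE\<close>, the
  semi-balanced systems are exactly the supports of nonzero vectors in exceptional cones.\<close>

lemma semi_balanced_supp:
  assumes "\<theta> \<in> exceptional_cone D" "\<theta> \<noteq> 0"
  shows "semi_balanced (supp \<theta>)"
  unfolding semi_balanced_def
proof (intro conjI exI)
  have ann: "\<theta> \<in> annihilators" using assms(1) by (rule exceptional_cone_annihilators)
  show nt: "nontrivial_system (supp \<theta>)"
    using ann assms(2) by (rule nontrivial_system_supp)
  show "constant_vector (lin_comb (supp \<theta>) (\<lambda>S. - \<theta> $ S))"
    using annihilator_lin_comb[OF ann _ nt] by (auto simp: constant_vector_def)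
  show "\<forall>S\<in>supp \<theta>. - \<theta> $ S \<noteq> 0" by (simp add: supp_def)
  have "{S \<in> supp \<theta>. - \<theta> $ S < 0} \<subseteq> {D}"
  proof clarify
    fix S assume "S \<in> supp \<theta>" "- \<theta> $ S < 0"
    then show "S = D"
      using exceptional_cone_nonpos[OF assms(1), of S] by (auto simp: supp_def)
  qed
  from card_mono[OF _ this] show "semi_conic_coeffs (supp \<theta>) (\<lambda>S. - \<theta> $ S)"
    by (simp add: semi_conic_coeffs_def)
qed

lemma semi_conic_relation_vector:
  assumes "nontrivial_system \<S>" "semi_conic_coeffs \<S> l" "lin_comb \<S> l = vec r"
  obtains D where "relation_vector \<S> l r \<in> exceptional_cone D"
proof -
  define A where "A = {S \<in> \<S>. l S < 0}"
  have eq: "S = T" if "S \<in> A" "T \<in> A" for S T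
    using assms(2) card_le_Suc0_iff_eq[of A] that by (simp add: semi_conic_coeffs_def A_def)
  obtain D where D: "S = D" if "S \<in> A" for S
  proof (cases "A = {}")
    case False
    then obtain D where "D \<in> A" by blast
    then show thesis using eq that by metis
  \<comment> \<open>Without negative coefficients any \<open>D\<close> will do.\<close>
  qed (use that in simp)
  have "relation_vector \<S> l r $ S \<le> 0" if "S \<notin> {{}, UNIV, D}" for S
  proof -
    have "S \<notin> A" using D[of S] that by blast
    then show ?thesis using that by (simp add: A_def relation_vector_def not_less)
  qed
  then have "relation_vector \<S> l r \<in> exceptional_cone D"
    using relation_vector_facts(3)[OF assms(1,3)] by (auto simp: exceptional_cone_def)
  then show thesis by (rule that)
qed

lemma semi_balancedE:
  assumes "semi_balanced \<S>"
  obtains D \<theta> where "\<theta> \<in> exceptional_cone D" "supp \<theta> = \<S>" "\<theta> \<noteq> 0"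
proof -
  obtain l r where nt: "nontrivial_system \<S>" and l: "semi_conic_coeffs \<S> l" "\<forall>S\<in>\<S>. l S \<noteq> 0"
    "lin_comb \<S> l = vec r"
    using assms by (auto simp: semi_balanced_def constant_vector_def)
  obtain D where "relation_vector \<S> l r \<in> exceptional_cone D"
    by (rule semi_conic_relation_vector[OF nt l(1,3)])
  moreover have supp: "supp (relation_vector \<S> l r) = \<S>"
    using relation_vector_facts(1)[OF nt, of l r] l(2) by blast
  moreover have "relation_vector \<S> l r \<noteq> 0"
  proof
    assume "relation_vector \<S> l r = 0"
    then have "supp (relation_vector \<S> l r) = {}" by (simp add: supp_def)
    then show False using nt supp by (simp add: nontrivial_system_def)
  qed
  ultimately show thesis by (rule that)
qed

lemma supp_eq_if_min_semi_balanced: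
  assumes "min_semi_balanced \<S>" "\<theta> \<in> exceptional_cone D" "\<theta> \<noteq> 0" "supp \<theta> \<subseteq> \<S>"
  shows "supp \<theta> = \<S>"
  using assms(1,4) semi_balanced_supp[OF assms(2,3)] unfolding min_semi_balanced_def by blast

lemma min_semi_balanced_nontrivial: "min_semi_balanced \<S> \<Longrightarrow> nontrivial_system \<S>"
  by (simp add: min_semi_balanced_def semi_balanced_def)

lemma supp_subsetD:
  assumes "supp \<theta>' \<subseteq> supp \<theta>" "S \<noteq> {}" "S \<noteq> UNIV" "\<theta>' $ S \<noteq> 0"
  shows "\<theta> $ S \<noteq> 0"
proof -
  have "S \<in> supp \<theta>'" using assms(2-4) by (simp add: supp_def)
  then have "S \<in> supp \<theta>" using assms(1) by blast
  then show ?thesis by (simp add: supp_def)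
qed

lemma supp_diff_psubset:
  assumes "supp \<theta>' \<subseteq> supp \<theta>" "S \<in> supp \<theta>" "\<theta> $ S = t * \<theta>' $ S"
  shows "supp (\<theta> - t *\<^sub>R \<theta>') \<subset> supp \<theta>"
proof
  show "supp (\<theta> - t *\<^sub>R \<theta>') \<subseteq> supp \<theta>"
  proof
    fix R assume R: "R \<in> supp (\<theta> - t *\<^sub>R \<theta>')"
    show "R \<in> supp \<theta>"
    proof (rule ccontr)
      assume n: "R \<notin> supp \<theta>"
      then have "R \<notin> supp \<theta>'" using assms(1) by blast
      then have "\<theta> $ R = 0" "\<theta>' $ R = 0" using R n by (simp_all add: supp_def)
      then show False using R by (simp add: supp_def)
    qed
  qed
  have "S \<notin> supp (\<theta> - t *\<^sub>R \<theta>')" using assms(3) by (simp add: supp_def)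
  then show "supp (\<theta> - t *\<^sub>R \<theta>') \<noteq> supp \<theta>" using assms(2) by blast
qed

section \<open>Uniqueness of coefficients for min-semi-balanced systems\<close>

text \<open>The ratio test leaves a difference with strictly smaller support, which is zero by
  minimality.\<close>

lemma min_semi_balanced_proportional:
  assumes \<S>: "min_semi_balanced \<S>"
    and \<theta>: "\<theta> \<in> exceptional_cone D" "\<theta> \<noteq> 0" "supp \<theta> \<subseteq> \<S>"
    and \<theta>': "\<theta>' \<in> exceptional_cone D'" "\<theta>' \<noteq> 0" "supp \<theta>' \<subseteq> \<S>"
  obtains t where "0 < t" "\<theta> = t *\<^sub>R \<theta>'"
proof -
  note eq = supp_eq_if_min_semi_balanced[OF \<S> \<theta>] supp_eq_if_min_semi_balanced[OF \<S> \<theta>']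
  have neg: "\<theta> $ S \<noteq> 0" if "S \<notin> {{}, UNIV, D}" "\<theta>' $ S < 0" for S
    using supp_subsetD[of \<theta>' \<theta> S] eq that by simp
  obtain t S where t: "0 < t" and S: "S \<in> supp \<theta>" "\<theta> $ S = t * \<theta>' $ S"
    and mem: "\<theta> - t *\<^sub>R \<theta>' \<in> exceptional_cone D"
    using exceptional_cone_subtract[OF \<theta>(1) \<theta>'(1,2) neg] by blast
  have "supp (\<theta> - t *\<^sub>R \<theta>') \<subset> \<S>"
    using supp_diff_psubset[OF _ S] eq by simp
  then have "\<theta> - t *\<^sub>R \<theta>' = 0"
    using supp_eq_if_min_semi_balanced[OF \<S> mem] by blast
  then show thesis using t that by simp
qed

text \<open>Affine semi-conic coefficients give a vector proportional to \<open>\<theta>\<close>.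
  The product with \<open>unit_game\<close>, which is the sum of the coefficients, is 1 for both, so
  the definite descriptions behind \<open>theta_vector\<close> are determined.\<close>

lemma theta_vector_eqI:
  assumes \<S>: "min_semi_balanced \<S>"
    and \<theta>: "\<theta> \<in> exceptional_cone D" "supp \<theta> \<subseteq> \<S>" "\<theta> \<bullet> unit_game = 1"
  shows "theta_vector \<S> = \<theta>"
proof -
  note nt = min_semi_balanced_nontrivial[OF \<S>]
  note ann = exceptional_cone_annihilators[OF \<theta>(1)]
  have nt': "{} \<notin> \<S>" "UNIV \<notin> \<S>" using nt by (auto simp: nontrivial_system_def)
  have "\<theta> \<noteq> 0" using \<theta>(3) by auto
  have lc: "lin_comb \<S> (\<lambda>S. - \<theta> $ S) = vec (\<theta> $ UNIV)"
    by (rule annihilator_lin_comb[OF ann \<theta>(2) nt])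
  define l where "l = (\<lambda>S. if S \<in> \<S> then - \<theta> $ S else 0)"
  have lcl: "lin_comb \<S> l = vec (\<theta> $ UNIV)"
    unfolding lc[symmetric] by (auto simp: lin_comb_def l_def intro: sum.cong)
  have uniq: "l' = l" if l': "\<forall>S. S \<notin> \<S> \<longrightarrow> l' S = 0" "affine_coeffs \<S> l'" "semi_conic_coeffs \<S> l'"
    "constant_vector (lin_comb \<S> l')" for l'
  proof -
    obtain r where r: "lin_comb \<S> l' = vec r" using l'(4) by (auto simp: constant_vector_def)
    let ?v = "relation_vector \<S> l' r"
    note facts = relation_vector_facts[OF nt, of l' r]
    have one: "?v \<bullet> unit_game = 1"
      using facts(2) l'(2) by (simp add: affine_coeffs_def)
    then have nz: "?v \<noteq> 0" by auto
    obtain D' where D': "?v \<in> exceptional_cone D'"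
      by (rule semi_conic_relation_vector[OF nt l'(3) r])
    have "supp ?v \<subseteq> \<S>" using facts(1) by blast
    from min_semi_balanced_proportional[OF \<S> D' nz this \<theta>(1) \<open>\<theta> \<noteq> 0\<close> \<theta>(2)]
    obtain t where "?v = t *\<^sub>R \<theta>" by blast
    with one \<theta>(3) have "?v = \<theta>" by simp
    show "l' = l"
    proof
      fix S
      have "?v $ S = \<theta> $ S" using \<open>?v = \<theta>\<close> by simp
      then show "l' S = l S"
        using l'(1) by (cases "S \<in> \<S>") (simp_all add: l_def relation_vector_def)
    qed
  qed
  have "card {S \<in> \<S>. l S < 0} \<le> card {D}"
  proof (intro card_mono subsetI)
    fix S assume "S \<in> {S \<in> \<S>. l S < 0}"
    then have S: "S \<in> \<S>" "0 < \<theta> $ S" by (auto simp: l_def)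
    then have "S \<notin> {{}, UNIV}" using nt' by blast
    then show "S \<in> {D}"
      using exceptional_cone_nonpos[OF \<theta>(1), of S] S(2) by (cases "S = D") simp_all
  qed simp
  then have semi: "semi_conic_coeffs \<S> l" by (simp add: semi_conic_coeffs_def)
  have aff: "affine_coeffs \<S> l"
    using \<theta>(3) unit_game_inner[OF \<theta>(2) nt'] by (simp add: affine_coeffs_def l_def sum_negf)
  have coeffs: "msb_coeffs \<S> = l"
    unfolding msb_coeffs_def
    by (rule the_equality) (use semi aff lcl uniq in \<open>auto simp: l_def constant_vector_def\<close>)
  have const: "msb_constant \<S> = \<theta> $ UNIV"
    unfolding msb_constant_def coeffs lcl by (rule the_equality) auto
  have "\<theta> $ {} = 1 - \<theta> $ UNIV"
    using annihilatorsD(1)[OF ann] \<theta>(3) unit_game_inner[OF \<theta>(2) nt'] inner_eq_sum_supp[OF \<theta>(2) nt', of 1]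
    by simp
  moreover have "\<theta> $ L = 0" if "L \<notin> \<S>" "L \<noteq> {}" "L \<noteq> UNIV" for L
    using \<theta>(2) that by (auto simp: supp_def)
  ultimately show ?thesis
    by (auto simp: theta_vector_def vec_eq_iff coeffs const l_def)
qed

lemma theta_vectorE:
  assumes "min_semi_balanced \<S>"
  obtains D where "theta_vector \<S> \<in> exceptional_cone D" "supp (theta_vector \<S>) = \<S>"
    "theta_vector \<S> \<bullet> unit_game = 1"
proof -
  have "semi_balanced \<S>" using assms by (simp add: min_semi_balanced_def)
  then obtain D \<theta> where \<theta>: "\<theta> \<in> exceptional_cone D" "supp \<theta> = \<S>" "\<theta> \<noteq> 0"
    by (rule semi_balancedE)
  have pos: "\<theta> \<bullet> unit_game > 0" using \<theta> by (simp add: exceptional_cone_pos)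
  define \<theta>' where "\<theta>' = (1 / (\<theta> \<bullet> unit_game)) *\<^sub>R \<theta>"
  have \<theta>': "\<theta>' \<in> exceptional_cone D" "supp \<theta>' = \<S>" "\<theta>' \<bullet> unit_game = 1"
    using \<theta> pos unfolding \<theta>'_def by (auto intro!: exceptional_cone_scaleR simp: supp_def)
  then have "theta_vector \<S> = \<theta>'"
    using assms by (intro theta_vector_eqI[where D=D]) auto
  then show thesis using \<theta>' that by simp
qed

section \<open>Finite description of the exact cone\<close>

text \<open>A nonzero vector of an exceptional cone loses support when a suitable multiple of
  \<open>theta_vector \<S>\<close> is subtracted, for a minimal semi-balanced \<open>\<S>\<close>
  inside its support. By induction on the support, nonnegativity on the vectors
  \<open>theta_vector \<S>\<close> carries over to all exceptional cones.\<close>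

lemma exact_cone_eq:
  "exact_cone = {m. m $ {} = 0 \<and> (\<forall>\<S>. min_semi_balanced \<S> \<longrightarrow> 0 \<le> theta_vector \<S> \<bullet> m)}"
proof -
  have "0 \<le> \<theta> \<bullet> m" if m: "\<forall>\<S>. min_semi_balanced \<S> \<longrightarrow> 0 \<le> theta_vector \<S> \<bullet> m"
    and "\<theta> \<in> exceptional_cone D" for m \<theta> :: "real ^ ('a set)" and D
    using that(2)
  proof (induction "card (supp \<theta>)" arbitrary: \<theta> rule: less_induct)
    case less
    show ?case
    proof (cases "\<theta> = 0")
      case False
      define \<C> where "\<C> = {\<C>. \<C> \<subseteq> supp \<theta> \<and> semi_balanced \<C>}"
      have "\<C> \<noteq> {}" using semi_balanced_supp[OF less.prems False] by (auto simp: \<C>_def)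
      then obtain \<S> where \<S>: "\<S> \<in> \<C>" "\<forall>\<B>\<in>\<C>. \<B> \<subseteq> \<S> \<longrightarrow> \<S> = \<B>"
        using finite_has_minimal[of \<C>] by auto
      then have msb: "min_semi_balanced \<S>" and sub: "\<S> \<subseteq> supp \<theta>"
        unfolding min_semi_balanced_def \<C>_def by auto
      define \<theta>' where "\<theta>' = theta_vector \<S>"
      obtain D' where D': "\<theta>' \<in> exceptional_cone D'" "supp \<theta>' = \<S>" "\<theta>' \<bullet> unit_game = 1"
        unfolding \<theta>'_def by (rule theta_vectorE[OF msb])
      have neg: "\<theta> $ S \<noteq> 0" if "S \<notin> {{}, UNIV, D}" "\<theta>' $ S < 0" for S
        using supp_subsetD[of \<theta>' \<theta> S] D'(2) sub that by simp
      have "\<theta>' \<noteq> 0" using D'(3) by auto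
      then obtain t S where t: "0 < t" and S: "S \<in> supp \<theta>" "\<theta> $ S = t * \<theta>' $ S"
        and mem: "\<theta> - t *\<^sub>R \<theta>' \<in> exceptional_cone D"
        using exceptional_cone_subtract[OF less.prems D'(1) _ neg] by blast
      have "0 \<le> (\<theta> - t *\<^sub>R \<theta>') \<bullet> m"
        using supp_diff_psubset[OF _ S] sub D'(2) mem
        by (intro less.hyps psubset_card_mono) auto
      moreover have "0 \<le> t * (\<theta>' \<bullet> m)" using m msb t by (simp add: \<theta>'_def)
      ultimately show ?thesis by (simp add: inner_diff_left)
    qed simp
  qed
  moreover have "\<exists>D. theta_vector \<S> \<in> exceptional_cone D" if "min_semi_balanced \<S>"
    for \<S> :: "'a set set"
    using theta_vectorE[OF that] by blast
  ultimately show ?thesis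
    unfolding exact_cone_def exact_game_iff by blast
qed

section \<open>Facets of a cone cut out by finitely many inequalities\<close>

text \<open>The inequalities are strict at \<open>u\<close>, so the cone contains a neighbourhood of
  \<open>u\<close> in \<open>L\<close>.\<close>

lemma affine_hull_dual_cone:
  fixes G :: "'a::euclidean_space set"
  assumes "finite G" "subspace L" "u \<in> L" and pos: "\<And>g. g \<in> G \<Longrightarrow> 0 < g \<bullet> u"
  shows "affine hull {m \<in> L. \<forall>g\<in>G. 0 \<le> g \<bullet> m} = L"
proof
  have aff: "affine L" using assms(2) by (rule subspace_imp_affine)
  show "affine hull {m \<in> L. \<forall>g\<in>G. 0 \<le> g \<bullet> m} \<subseteq> L"
    using aff by (intro hull_minimal) auto
  define T where "T = (\<Inter>g\<in>G. {m. g \<bullet> m > 0})"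
  have "open T"
    unfolding T_def using assms(1) by (intro open_INT ballI open_halfspace_gt) auto
  moreover have "u \<in> L \<inter> T" using assms by (simp add: T_def)
  ultimately have "affine hull (L \<inter> T) = affine hull L"
    using aff by (intro affine_hull_affine_Int_open) auto
  also have "\<dots> = L" using aff by (rule affine_hull_eq[THEN iffD2])
  finally have "L = affine hull (L \<inter> T)" ..
  also have "\<dots> \<subseteq> affine hull {m \<in> L. \<forall>g\<in>G. 0 \<le> g \<bullet> m}"
    by (intro hull_mono) (auto simp: T_def less_imp_le)
  finally show "L \<subseteq> affine hull {m \<in> L. \<forall>g\<in>G. 0 \<le> g \<bullet> m}" .
qed

text \<open>A minimal set \<open>H\<close> of inequalities that still describes \<open>K\<close> is
  irredundant, and the facets of a polyhedron correspond to an irredundant description.\<close>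

lemma facets_of_dual_cone:
  fixes G :: "'a::euclidean_space set"
  assumes "finite G" "subspace L" "u \<in> L" and pos: "\<And>g. g \<in> G \<Longrightarrow> 0 < g \<bullet> u"
    and K: "K = {m \<in> L. \<forall>g\<in>G. 0 \<le> g \<bullet> m}"
  obtains H where "H \<subseteq> G" "K = {m \<in> L. \<forall>g\<in>H. 0 \<le> g \<bullet> m}"
    "\<And>C. C facet_of K \<longleftrightarrow> (\<exists>h\<in>H. C = {m \<in> K. h \<bullet> m = 0})"
proof -
  define \<H> where "\<H> = {H. H \<subseteq> G \<and> K = {m \<in> L. \<forall>g\<in>H. 0 \<le> g \<bullet> m}}"
  have "finite \<H>" "\<H> \<noteq> {}"
    using assms(1) K by (auto simp: \<H>_def)
  then obtain H where H: "H \<in> \<H>" and min: "\<forall>B\<in>\<H>. B \<subseteq> H \<longrightarrow> H = B"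
    using finite_has_minimal by blast
  from H have HG: "H \<subseteq> G" and KH: "K = {m \<in> L. \<forall>g\<in>H. 0 \<le> g \<bullet> m}"
    by (simp_all add: \<H>_def)
  have finH: "finite H" using HG assms(1) finite_subset by blast
  have hull: "affine hull K = L"
    unfolding K using assms(1-4) by (rule affine_hull_dual_cone)
  \<comment> \<open>The facet criterion is indexed by half-spaces: \<open>hs\<close> sends a normal
    to its half-space, and \<open>a\<close> picks a normal back, negated to suit the form
    \<open>\<le> 0\<close>.\<close>
  define hs where "hs = (\<lambda>g::'a. {x. - g \<bullet> x \<le> 0})"
  define a where "a = (\<lambda>h. - (SOME g. g \<in> H \<and> h = hs g))"
  have a: "- a h \<in> H \<and> h = hs (- a h)" if "h \<in> hs ` H" for h
  proof -
    have "\<exists>g. g \<in> H \<and> h = hs g" using that by blast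
    from someI_ex[OF this] show ?thesis by (simp add: a_def)
  qed
  have facets: "C facet_of K \<longleftrightarrow> (\<exists>h. h \<in> hs ` H \<and> C = K \<inter> {x. a h \<bullet> x = 0})" for C
  proof (rule facet_of_polyhedron_explicit)
    show "finite (hs ` H)" using finH by simp
    show "K = affine hull K \<inter> \<Inter> (hs ` H)"
      unfolding hull by (subst KH) (auto simp: hs_def)
    show "a h \<noteq> 0 \<and> h = {x. a h \<bullet> x \<le> 0}" if "h \<in> hs ` H" for h
      using a[OF that] pos[of "- a h"] HG by (auto simp: hs_def)
    fix F' assume F': "F' \<subset> hs ` H"
    define H' where "H' = {g \<in> H. hs g \<in> F'}"
    have F'_eq: "F' = hs ` H'" using F' by (auto simp: H'_def)
    then have "H' \<subset> H" using F' by (auto simp: H'_def)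
    then have "H' \<notin> \<H>" using min by blast
    then have "K \<noteq> {m \<in> L. \<forall>g\<in>H'. 0 \<le> g \<bullet> m}"
      using HG \<open>H' \<subset> H\<close> by (auto simp: \<H>_def)
    moreover have "K \<subseteq> {m \<in> L. \<forall>g\<in>H'. 0 \<le> g \<bullet> m}"
      using \<open>H' \<subset> H\<close> by (subst KH) auto
    moreover have "affine hull K \<inter> \<Inter> F' = {m \<in> L. \<forall>g\<in>H'. 0 \<le> g \<bullet> m}"
      unfolding hull F'_eq by (auto simp: hs_def)
    ultimately show "K \<subset> affine hull K \<inter> \<Inter> F'" by blast
  qed
  \<comment> \<open>The normal picked for \<open>hs g\<close> need not be \<open>- g\<close>, but
    the half-space alone determines its bounding hyperplane.\<close>
  have zero: "g \<bullet> x = 0 \<longleftrightarrow> x \<in> hs g \<and> - x \<in> hs g" for g x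
    by (auto simp: hs_def)
  have eq: "K \<inter> {x. a (hs g) \<bullet> x = 0} = {m \<in> K. g \<bullet> m = 0}" if "g \<in> H" for g
  proof -
    have "hs (- a (hs g)) = hs g" using a[of "hs g"] that by blast
    then have "(- a (hs g)) \<bullet> x = 0 \<longleftrightarrow> g \<bullet> x = 0" for x
      unfolding zero by simp
    then show ?thesis by auto
  qed
  show thesis
  proof (rule that[OF HG KH])
    show "C facet_of K \<longleftrightarrow> (\<exists>h\<in>H. C = {m \<in> K. h \<bullet> m = 0})" for C
      unfolding facets using eq by auto
  qed
qed

text \<open>A facet together with a point of \<open>K\<close> off its hyperplane spans the affine
  hull of \<open>K\<close>, so a functional vanishing on both vanishes on that hull.\<close>

lemma facet_normal_unique:
  fixes K :: "'a::euclidean_space set"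
  assumes facet: "{m \<in> K. \<theta> \<bullet> m = 0} facet_of K" and u: "u \<in> K" "\<theta> \<bullet> u > 0"
    and \<phi>: "\<And>m. m \<in> K \<Longrightarrow> \<theta> \<bullet> m = 0 \<Longrightarrow> \<phi> \<bullet> m = 0"
    and m: "m \<in> affine hull K"
  shows "\<phi> \<bullet> m = ((\<phi> \<bullet> u) / (\<theta> \<bullet> u)) * (\<theta> \<bullet> m)"
proof -
  define F where "F = {m \<in> K. \<theta> \<bullet> m = 0}"
  \<comment> \<open>The multiple of \<open>\<theta>\<close> is chosen so that \<open>\<psi>\<close>
    vanishes at \<open>u\<close>.\<close>
  define \<psi> where "\<psi> = \<phi> - ((\<phi> \<bullet> u) / (\<theta> \<bullet> u)) *\<^sub>R \<theta>"
  have "affine hull F \<subseteq> {x. \<theta> \<bullet> x = 0}"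
    by (intro hull_minimal affine_hyperplane) (auto simp: F_def)
  then have "u \<notin> affine hull F" using u by auto
  then have dim: "aff_dim (insert u F) = aff_dim K"
    using facet by (simp add: aff_dim_insert facet_of_def F_def)
  have "affine hull (insert u F) = affine hull K"
    using u dim by (intro affine_dim_equal hull_mono) (auto simp: F_def aff_dim_affine_hull)
  moreover have "affine hull (insert u F) \<subseteq> {x. \<psi> \<bullet> x = 0}"
    using u \<phi> by (intro hull_minimal affine_hyperplane) (auto simp: F_def \<psi>_def inner_diff_left)
  ultimately have "\<psi> \<bullet> m = 0" using m by blast
  then show ?thesis by (simp add: \<psi>_def inner_diff_left)
qed

section \<open>Splittings for balanced or decomposable systems\<close>

text \<open>Modularity over the union and intersection of \<open>A\<close> and \<open>C\<close>
  gives the vector. Choosing \<open>C\<close> so that one of these two is trivial leaves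
  \<open>E\<close> as the only nontrivial set with a positive entry.\<close>

lemma modular_relation:
  fixes A :: "'n::finite set"
  assumes "CARD('n) \<ge> 3" "A \<noteq> {}" "A \<noteq> UNIV"
  obtains C E u where "u \<in> annihilators" "C \<notin> {{}, UNIV, A}" "E \<notin> {{}, UNIV, A, C}"
    "u $ A = -1" "u $ C = -1" "u $ E = 1" "\<And>S. S \<notin> {{}, UNIV, A, C, E} \<Longrightarrow> u $ S = 0"
proof -
  define u where "u = (\<lambda>C. axis (A \<union> C) 1 + axis (A \<inter> C) 1 - axis A 1 - axis C (1::real))"
  have ann: "u C \<in> annihilators" for C
  proof -
    have "u C \<bullet> modular_game x = 0" for x
      using sum.union_inter[of A C "\<lambda>i. x $ i"]
      by (simp add: u_def inner_diff_left inner_add_left inner_axis' modular_game_def)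
    then show ?thesis
      by (simp add: annihilators_def) (simp add: u_def inner_diff_left inner_add_left inner_axis')
  qed
  obtain a where a: "a \<in> A" using assms(2) by blast
  show thesis
  proof (cases "A = {a}")
    case True
    have "card (UNIV - {a}) \<ge> 2" using assms(1) by simp
    then obtain b where b: "b \<noteq> a" by (metis DiffD2 card.empty equals0I insertI1 not_numeral_le_zero)
    have nu: "{a, b} \<noteq> UNIV"
    proof
      assume "{a, b} = UNIV"
      then have "CARD('n) = card {a, b}" by simp
      also have "\<dots> \<le> 2" by (simp add: card_insert_if)
      finally show False using assms(1) by simp
    qed
    \<comment> \<open>Disjoint singletons have trivial intersection, and a third point keeps their
      union proper.\<close>
    show thesis
    proof (rule that[of "u {b}" "{b}" "{a, b}"])
      show "{b} \<notin> {{}, UNIV, A}" "{a, b} \<notin> {{}, UNIV, A, {b}}"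
        using b nu True by auto
      show "u {b} $ A = -1" "u {b} $ {b} = -1" "u {b} $ {a, b} = 1"
        "\<And>S. S \<notin> {{}, UNIV, A, {b}, {a, b}} \<Longrightarrow> u {b} $ S = 0"
        using b True by (auto simp: u_def axis_def)
    qed (rule ann)
  next
    case False
    then obtain b where b: "b \<in> A" "b \<noteq> a" using a by blast
    obtain c where c: "c \<notin> A" using assms(3) by blast
    have un: "A \<union> - {a} = UNIV" and int: "A \<inter> - {a} = A - {a}" using a by auto
    have ne: "A - {a} \<noteq> {}" "A - {a} \<noteq> UNIV" "A - {a} \<noteq> A" "A - {a} \<noteq> - {a}"
      "- {a} \<noteq> {}" "- {a} \<noteq> UNIV" "- {a} \<noteq> A"
      using a b c by blast+
    \<comment> \<open>Here the union is \<open>UNIV\<close>, and the intersection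
      \<open>A - {a}\<close> is nonempty because of \<open>b\<close>.\<close>
    show thesis
    proof (rule that[of "u (- {a})" "- {a}" "A - {a}"])
      show "- {a} \<notin> {{}, UNIV, A}" "A - {a} \<notin> {{}, UNIV, A, - {a}}"
        using ne by blast+
      show "u (- {a}) $ A = -1" "u (- {a}) $ (- {a}) = -1" "u (- {a}) $ (A - {a}) = 1"
        "\<And>S. S \<notin> {{}, UNIV, A, - {a}, A - {a}} \<Longrightarrow> u (- {a}) $ S = 0"
        unfolding u_def un int using ne ne[symmetric] assms(3) by (simp_all add: axis_def)
    qed (rule ann)
  qed
qed

text \<open>If \<open>\<S>\<close> were balanced or had a decomposition,
  \<open>theta_vector \<S>\<close> would split into two exceptional vectors, one of them not a
  multiple of it.\<close>

lemma indecomposable_if_extremal: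
  fixes \<S> :: "'n::finite set set"
  assumes card: "CARD('n) \<ge> 3" and msb: "min_semi_balanced \<S>"
    and ext: "\<And>\<theta>1 \<theta>2 D1 D2. \<theta>1 \<in> exceptional_cone D1 \<Longrightarrow> \<theta>2 \<in> exceptional_cone D2 \<Longrightarrow>
      \<theta>1 + \<theta>2 = theta_vector \<S> \<Longrightarrow> \<exists>c. \<theta>1 = c *\<^sub>R theta_vector \<S>"
  shows "indecomposable_min_semi_balanced \<S>"
proof -
  define \<theta> where "\<theta> = theta_vector \<S>"
  obtain D where \<theta>: "\<theta> \<in> exceptional_cone D" "supp \<theta> = \<S>" "\<theta> \<bullet> unit_game = 1"
    unfolding \<theta>_def by (rule theta_vectorE[OF msb])
  note nt = min_semi_balanced_nontrivial[OF msb]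
  have nt': "{} \<notin> \<S>" "UNIV \<notin> \<S>" using nt by (auto simp: nontrivial_system_def)
  have zero: "\<theta> $ S = 0" if "S \<notin> \<S>" "S \<noteq> {}" "S \<noteq> UNIV" for S
  proof -
    have "S \<notin> supp \<theta>" using \<theta>(2) that by simp
    then show ?thesis using that by (simp add: supp_def)
  qed
  have nonzero: "\<theta> $ S \<noteq> 0" if "S \<in> \<S>" for S
  proof -
    have "S \<in> supp \<theta>" using \<theta>(2) that by simp
    then show ?thesis by (simp add: supp_def)
  qed
  have "\<not> balanced_system \<S>"
  proof
    assume "balanced_system \<S>"
    then obtain l where l: "conic_coeffs \<S> l" "\<forall>S\<in>\<S>. l S \<noteq> 0" "lin_comb \<S> l = incidence UNIV"
      unfolding balanced_system_def by blast
    define v where "v = relation_vector \<S> l 1"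
    have "lin_comb \<S> l = vec 1" using l(3) by (simp add: incidence_def vec_eq_iff)
    note facts = relation_vector_facts[OF nt, of l 1]
    have suppv: "supp v = \<S>" unfolding v_def facts(1) using l(2) by blast
    have "v $ S \<le> 0" if "S \<notin> {{}, UNIV}" for S
      using that l(1) by (auto simp: v_def relation_vector_def conic_coeffs_def)
    then have v: "v \<in> exceptional_cone {}"
      using facts(3) \<open>lin_comb \<S> l = vec 1\<close> by (simp add: exceptional_cone_def v_def)
    have "v \<noteq> 0"
    proof
      assume "v = 0"
      then have "supp v = {}" by (simp add: supp_def)
      then show False using suppv nt by (simp add: nontrivial_system_def)
    qed
    have "\<theta> \<noteq> 0" using \<theta>(3) by auto
    obtain t where "0 < t" "\<theta> = t *\<^sub>R v"
      by (rule min_semi_balanced_proportional[OF msb \<theta>(1) \<open>\<theta> \<noteq> 0\<close> _ v \<open>v \<noteq> 0\<close>]) (simp_all add: \<theta>(2) suppv)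
    then have \<theta>0: "\<theta> \<in> exceptional_cone {}" using v by (simp add: exceptional_cone_scaleR)
    obtain A where A: "A \<in> \<S>" using nt by (auto simp: nontrivial_system_def)
    then have A': "A \<noteq> {}" "A \<noteq> UNIV" using nt' by auto
    obtain C E u where u: "u \<in> annihilators" and C: "C \<notin> {{}, UNIV, A}" and E: "E \<notin> {{}, UNIV, A, C}"
      and uv: "u $ A = -1" "u $ C = -1" "u $ E = 1" "\<And>S. S \<notin> {{}, UNIV, A, C, E} \<Longrightarrow> u $ S = 0"
      by (rule modular_relation[OF card A']) blast
    \<comment> \<open>This factor cancels the entry at \<open>A\<close>, so \<open>C\<close> is the
      only nontrivial set at which \<open>\<theta> - t *\<^sub>R u\<close> can be positive.\<close>
    define t where "t = - \<theta> $ A"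
    have t: "t > 0"
      using exceptional_cone_nonpos[OF \<theta>0, of A] nonzero[OF A] A' by (simp add: t_def)
    have "u $ S \<le> 0" if "S \<notin> {{}, UNIV, E}" for S
      using uv(1,2) uv(4)[of S] that by (cases "S = A"; cases "S = C") auto
    then have uE: "u \<in> exceptional_cone E" using u by (simp add: exceptional_cone_def)
    have "(\<theta> - t *\<^sub>R u) $ S \<le> 0" if S: "S \<notin> {{}, UNIV, C}" for S
    proof -
      have "\<theta> $ S \<le> 0" using exceptional_cone_nonpos[OF \<theta>0, of S] S by blast
      consider "S = A" | "S = E" | "S \<notin> {{}, UNIV, A, C, E}" using S by blast
      then show ?thesis
      proof cases
        case 3
        then show ?thesis using \<open>\<theta> $ S \<le> 0\<close> uv(4)[of S] by simp
      qed (use \<open>\<theta> $ S \<le> 0\<close> uv t in \<open>simp_all add: t_def\<close>)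
    qed
    moreover have "\<theta> - t *\<^sub>R u \<in> annihilators"
      using u exceptional_cone_annihilators[OF \<theta>0]
      by (intro subspace_diff subspace_scale subspace_annihilators)
    ultimately have diff: "\<theta> - t *\<^sub>R u \<in> exceptional_cone C" by (simp add: exceptional_cone_def)
    have tu: "t *\<^sub>R u \<in> exceptional_cone E" using uE t by (simp add: exceptional_cone_scaleR)
    obtain c where c: "t *\<^sub>R u = c *\<^sub>R \<theta>"
      using ext[OF tu diff] by (auto simp: \<theta>_def)
    have "u \<noteq> 0" using uv(3) by auto
    \<comment> \<open>Products with \<open>unit_game\<close> force \<open>c > 0\<close>, whereas
      \<open>u\<close> is positive at \<open>E\<close> and \<open>\<theta>\<close> is not.\<close>
    then have "t * (u \<bullet> unit_game) > 0" using exceptional_cone_pos[OF uE] t by simp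
    moreover have "t * (u \<bullet> unit_game) = c"
      using arg_cong[OF c, of "\<lambda>v. v \<bullet> unit_game"] \<theta>(3) by simp
    ultimately have "c > 0" by simp
    moreover have "t = c * \<theta> $ E"
      using arg_cong[OF c, of "\<lambda>v. v $ E"] uv(3) by simp
    moreover have "\<theta> $ E \<le> 0" using exceptional_cone_nonpos[OF \<theta>0, of E] E by simp
    ultimately show False using t by (simp add: mult_nonneg_nonpos leD)
  qed
  moreover have "\<not> has_decomposition \<S>"
  proof
    assume "has_decomposition \<S>"
    then obtain E l r where E: "E \<notin> \<S>" "E \<noteq> {}" "E \<noteq> UNIV" and ntE: "nontrivial_system (insert E \<S>)"
      and l: "lin_comb (insert E \<S>) l = vec r" "l E < 0" "\<forall>S\<in>\<S> - {E}. l S \<ge> 0"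
      by (auto simp: has_decomposition_def exceptional_def constant_vector_def)
    \<comment> \<open>\<open>v\<close> is positive at \<open>E\<close>, where
      \<open>\<theta>\<close> vanishes, so no positive multiple of \<open>v\<close> is a multiple of
      \<open>\<theta>\<close>. The negative entries of \<open>v\<close> at nontrivial sets lie in
      \<open>\<S>\<close>, so the ratio test splits off such a multiple.\<close>
    define v where "v = relation_vector (insert E \<S>) l r"
    note facts = relation_vector_facts[OF ntE, of l r]
    have vE: "v $ E > 0" using l(2) by (simp add: v_def relation_vector_def)
    have vS: "v $ S \<le> 0" if "S \<notin> {{}, UNIV, E}" for S
      using that l(3) by (auto simp: v_def relation_vector_def)
    then have v: "v \<in> exceptional_cone E"
      using facts(3) l(1) by (simp add: exceptional_cone_def v_def)
    have neg: "\<theta> $ S \<noteq> 0" if S: "S \<notin> {{}, UNIV, D}" "v $ S < 0" for S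
    proof (rule nonzero)
      have "S \<in> supp v" using S by (simp add: supp_def)
      moreover have "S \<noteq> E" using S vE by auto
      ultimately show "S \<in> \<S>" unfolding v_def facts(1) by blast
    qed
    have "v \<noteq> 0" using vE by auto
    obtain t S where t: "0 < t" and diff: "\<theta> - t *\<^sub>R v \<in> exceptional_cone D"
      by (rule exceptional_cone_subtract[OF \<theta>(1) v \<open>v \<noteq> 0\<close> neg]) auto
    have tv: "t *\<^sub>R v \<in> exceptional_cone E" using v t by (simp add: exceptional_cone_scaleR)
    obtain c where c: "t *\<^sub>R v = c *\<^sub>R \<theta>"
      using ext[OF tv diff] by (auto simp: \<theta>_def)
    have "t * v $ E = c * \<theta> $ E" using arg_cong[OF c, of "\<lambda>v. v $ E"] by simp
    then show False using t vE zero[OF E] by simp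
  qed
  ultimately show ?thesis
    using msb by (simp add: indecomposable_min_semi_balanced_def purely_min_semi_balanced_def)
qed

section \<open>Eliminating summands outside an indecomposable system\<close>

lemma sum_nonpos_eq_0_iff:
  fixes f :: "'a \<Rightarrow> 'b::ordered_ab_group_add"
  shows "finite A \<Longrightarrow> (\<And>a. a \<in> A \<Longrightarrow> f a \<le> 0) \<Longrightarrow> sum f A = 0 \<longleftrightarrow> (\<forall>a\<in>A. f a = 0)"
  using sum_nonneg_eq_0_iff[of A "\<lambda>a. - f a"] by (simp add: sum_negf)

lemma exceptional_cone_emptyI:
  assumes "\<theta> \<in> exceptional_cone D" "D = {} \<or> D = UNIV \<or> \<theta> $ D \<le> 0"
  shows "\<theta> \<in> exceptional_cone {}"
proof -
  have "\<theta> $ S \<le> 0" if "S \<notin> {{}, UNIV}" for S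
    using exceptional_cone_nonpos[OF assms(1), of S] assms(2) that by (cases "S = D") blast+
  then show ?thesis
    using assms(1) by (simp add: exceptional_cone_def)
qed

text \<open>The constant \<open>\<theta> $ UNIV\<close> is positive, as any point of a set in the
  support shows; dividing by it normalizes the combination to the incidence vector of
  \<open>UNIV\<close>.\<close>

lemma balanced_supp:
  assumes "\<theta> \<in> exceptional_cone {}" "\<theta> \<noteq> 0"
  shows "balanced_system (supp \<theta>)"
proof -
  have ann: "\<theta> \<in> annihilators" using assms(1) by (rule exceptional_cone_annihilators)
  have nt: "nontrivial_system (supp \<theta>)" using ann assms(2) by (rule nontrivial_system_supp)
  have pos: "- \<theta> $ S > 0" if "S \<in> supp \<theta>" for S
    using exceptional_cone_nonpos[OF assms(1), of S] that by (simp add: supp_def)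
  define r where "r = \<theta> $ UNIV"
  have lc: "lin_comb (supp \<theta>) (\<lambda>S. - \<theta> $ S) = vec r"
    unfolding r_def using ann _ nt by (rule annihilator_lin_comb) simp
  obtain A i where A: "A \<in> supp \<theta>" "i \<in> A" using nt by (auto simp: nontrivial_system_def supp_def)
  have "r = (\<Sum>S\<in>supp \<theta>. - \<theta> $ S * incidence S $ i)"
    using arg_cong[OF lc, of "\<lambda>x. x $ i"] by (simp add: lin_comb_def)
  also have "\<dots> > 0"
    using A pos by (intro sum_pos2[where i=A]) (auto simp: incidence_def intro: less_imp_le)
  finally have "r > 0" .
  have "lin_comb (supp \<theta>) (\<lambda>S. - \<theta> $ S / r) = (1 / r) *\<^sub>R lin_comb (supp \<theta>) (\<lambda>S. - \<theta> $ S)"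
    by (simp add: lin_comb_def scaleR_sum_right)
  also have "\<dots> = incidence UNIV"
    unfolding lc using \<open>r > 0\<close> by (simp add: vec_eq_iff incidence_def)
  finally have lc': "lin_comb (supp \<theta>) (\<lambda>S. - \<theta> $ S / r) = incidence UNIV" .
  have pos': "- \<theta> $ S / r > 0" if "S \<in> supp \<theta>" for S
    using pos[OF that] \<open>r > 0\<close> by (rule divide_pos_pos)
  have "conic_coeffs (supp \<theta>) (\<lambda>S. - \<theta> $ S / r)"
    unfolding conic_coeffs_def using pos' by (blast intro: less_imp_le)
  moreover have "\<forall>S\<in>supp \<theta>. - \<theta> $ S / r \<noteq> 0"
    using pos' by (metis less_irrefl)
  ultimately show ?thesis
    unfolding balanced_system_def using nt lc' by blast
qed

text \<open>
  If \<open>f D\<close> is nonzero at a set \<open>D\<close> outside the system, then \<open>D\<close> can be eliminated: the entries of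
  the summands at \<open>D\<close> add up to zero, so adding suitable nonnegative multiples of \<open>f D\<close> to
  the other summands makes all entries at \<open>D\<close> vanish without changing the sum. The last
  such \<open>D\<close> would yield a decomposition.
\<close>
lemma indecomposable_sum_outside:
  assumes indec: "indecomposable_min_semi_balanced \<S>"
    and f: "\<And>D. f D \<in> exceptional_cone D" and sum: "(\<Sum>D\<in>UNIV. f D) = theta_vector \<S>"
    and "D0 \<notin> \<S>"
  shows "f D0 = 0"
proof -
  have msb: "min_semi_balanced \<S>" and nb: "\<not> balanced_system \<S>" and nd: "\<not> has_decomposition \<S>"
    using indec by (simp_all add: indecomposable_min_semi_balanced_def purely_min_semi_balanced_def)
  note nt = min_semi_balanced_nontrivial[OF msb]
  have supp_\<theta>: "supp (theta_vector \<S>) = \<S>" using theta_vectorE[OF msb] by blast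
  have sum0: "(\<Sum>D\<in>UNIV. f D $ A) = 0"
    if "(\<Sum>D\<in>UNIV. f D) = theta_vector \<S>" "A \<notin> \<S>" "A \<noteq> {}" "A \<noteq> UNIV" for f A
  proof -
    have "A \<notin> supp (theta_vector \<S>)" using supp_\<theta> that by simp
    then have "theta_vector \<S> $ A = 0" using that by (simp add: supp_def)
    then show ?thesis using arg_cong[OF that(1), of "\<lambda>x. x $ A"] by simp
  qed
  \<comment> \<open>With \<open>Suc k\<close> the induction starts from a single remaining set,
    where the contradiction arises.\<close>
  have "card {D. D \<notin> \<S> \<and> f D \<noteq> 0} \<noteq> Suc k"
    if "\<And>D. f D \<in> exceptional_cone D" "(\<Sum>D\<in>UNIV. f D) = theta_vector \<S>" for k f
    using that
  proof (induction k arbitrary: f)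
    case (0 f)
    show ?case
    proof
      assume "card {D. D \<notin> \<S> \<and> f D \<noteq> 0} = Suc 0"
      then obtain D where D: "{D. D \<notin> \<S> \<and> f D \<noteq> 0} = {D}"
        unfolding One_nat_def[symmetric] by (rule card_1_singletonE)
      then have DS: "D \<notin> \<S>" "f D \<noteq> 0" by blast+
      \<comment> \<open>No summand is positive at such an \<open>A\<close>, and the entries there
        add up to zero, so all of them vanish.\<close>
      have fD: "f D $ A = 0" if A: "A \<notin> \<S>" "A \<noteq> {}" "A \<noteq> UNIV" "f A $ A \<le> 0" for A
      proof -
        have "f B $ A \<le> 0" for B
          using exceptional_cone_nonpos[OF 0(1)[of B], of A] A by (cases "A = B") blast+
        then have "f B $ A = 0" for B
          using sum0[OF 0(2) A(1-3)] sum_nonpos_eq_0_iff[of UNIV "\<lambda>B. f B $ A"] by simp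
        then show ?thesis .
      qed
      have fD': "f D $ A = 0" if A: "A \<notin> \<S>" "A \<noteq> {}" "A \<noteq> UNIV" "A \<noteq> D" for A
      proof -
        have "f A = 0" using D A by blast
        then show ?thesis using fD[OF A(1-3)] by simp
      qed
      show False
      proof (cases "D = {} \<or> D = UNIV \<or> f D $ D \<le> 0")
        case True
        have "f D $ A = 0" if A: "A \<notin> \<S>" "A \<noteq> {}" "A \<noteq> UNIV" for A
          using fD[OF A] fD'[OF A] True A by (cases "A = D") blast+
        then have sub: "supp (f D) \<subseteq> \<S>" unfolding supp_def by blast
        have emp: "f D \<in> exceptional_cone {}"
          by (rule exceptional_cone_emptyI[OF 0(1) True])
        \<comment> \<open>By minimality \<open>f D\<close> uses all of \<open>\<S>\<close>, which
          would therefore be balanced.\<close>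
        have "supp (f D) = \<S>"
          by (rule supp_eq_if_min_semi_balanced[OF msb emp DS(2) sub])
        then show False using balanced_supp[OF emp DS(2)] nb by simp
      next
        case False
        have sub: "supp (f D) \<subseteq> insert D \<S>" using fD' unfolding supp_def by blast
        have nt': "nontrivial_system (insert D \<S>)" using nt False by (simp add: nontrivial_system_def)
        have ann: "f D \<in> annihilators" by (rule exceptional_cone_annihilators[OF 0(1)])
        have "- f D $ S \<ge> 0" if "S \<in> insert D \<S> - {D}" for S
          using exceptional_cone_nonpos[OF 0(1)[of D], of S] nt that DS(1)
          by (auto simp: nontrivial_system_def)
        moreover have "constant_vector (lin_comb (insert D \<S>) (\<lambda>S. - f D $ S))"
          unfolding constant_vector_def using annihilator_lin_comb[OF ann sub nt'] by blast
        moreover have "- f D $ D < 0" using False by simp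
        ultimately have "exceptional D (insert D \<S>)"
          unfolding exceptional_def using nt' by blast
        then have "has_decomposition \<S>"
          unfolding has_decomposition_def using DS(1) False by (intro exI[of _ D]) simp
        then show False using nd by simp
      qed
    qed
  next
    case (Suc k f)
    show ?case
    proof
      assume card: "card {D. D \<notin> \<S> \<and> f D \<noteq> 0} = Suc (Suc k)"
      then have "{D. D \<notin> \<S> \<and> f D \<noteq> 0} \<noteq> {}" by (metis card.empty nat.distinct(1))
      then obtain D where D: "D \<notin> \<S>" "f D \<noteq> 0" by blast
      have contra: False if "\<And>D. f' D \<in> exceptional_cone D" "(\<Sum>D\<in>UNIV. f' D) = theta_vector \<S>"
        "f' D = 0" "\<And>X. X \<notin> \<S> \<Longrightarrow> X \<noteq> D \<Longrightarrow> f' X = 0 \<longleftrightarrow> f X = 0" for f'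
      proof -
        have "{X. X \<notin> \<S> \<and> f' X \<noteq> 0} = {X. X \<notin> \<S> \<and> f X \<noteq> 0} - {D}"
          using that(3,4) by blast
        then have "card {X. X \<notin> \<S> \<and> f' X \<noteq> 0} = Suc k" using card D by simp
        with Suc.IH[OF that(1,2)] show False by simp
      qed
      show False
      proof (cases "D = {} \<or> D = UNIV \<or> f D $ D \<le> 0")
        case True
        obtain T where T: "T \<in> \<S>" using nt by (auto simp: nontrivial_system_def)
        \<comment> \<open>Since \<open>f D\<close> lies in every exceptional cone, it can be moved
          to a member \<open>T\<close> of the system.\<close>
        define f' where "f' X = f X + (if X = T then f D else 0) - (if X = D then f D else 0)" for X
        have "T \<noteq> D" using T D by blast
        have emp: "f D \<in> exceptional_cone {}"
          by (rule exceptional_cone_emptyI[OF Suc.prems(1) True])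
        show False
        proof (rule contra)
          show "f' X \<in> exceptional_cone X" for X
            using Suc.prems(1) exceptional_cone_empty_subset[OF emp] \<open>T \<noteq> D\<close>
            by (simp add: f'_def exceptional_cone_add)
          show "(\<Sum>X\<in>UNIV. f' X) = theta_vector \<S>"
            unfolding f'_def using Suc.prems(2) by (simp add: sum.distrib sum_subtractf)
        qed (use \<open>T \<noteq> D\<close> T in \<open>auto simp: f'_def\<close>)
      next
        case False
        define a where "a = f D $ D"
        have a: "a > 0" using False by (simp add: a_def)
        define b where "b X = - (f X $ D / a)" for X
        define f' where "f' X = f X + b X *\<^sub>R f D" for X
        have b: "b X \<ge> 0" if "X \<noteq> D" for X
        proof -
          have "f X $ D \<le> 0"
            using exceptional_cone_nonpos[OF Suc.prems(1)[of X], of D] False that by blast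
          then show ?thesis using a by (simp add: b_def divide_nonpos_pos)
        qed
        have f'D: "f' D = 0" using a by (simp add: f'_def b_def a_def)
        show False
        proof (rule contra[of f'])
          show "f' X \<in> exceptional_cone X" for X
          proof (cases "X = D")
            case XD: False
            have "f' X $ S \<le> 0" if S: "S \<notin> {{}, UNIV, X}" for S
            proof (cases "S = D")
              case True
              then show ?thesis using a by (simp add: f'_def b_def a_def)
            next
              case SD: False
              have "f X $ S \<le> 0" using exceptional_cone_nonpos[OF Suc.prems(1)[of X] S] .
              moreover have "f D $ S \<le> 0"
                using exceptional_cone_nonpos[OF Suc.prems(1)[of D], of S] S SD by blast
              ultimately show ?thesis
                using b[OF XD] by (simp add: f'_def add_nonpos_nonpos mult_nonneg_nonpos)
            qed
            moreover have "f' X \<in> annihilators"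
              unfolding f'_def using exceptional_cone_annihilators[OF Suc.prems(1)]
              by (intro subspace_add subspace_scale subspace_annihilators)
            ultimately show ?thesis by (simp add: exceptional_cone_def)
          qed (simp add: f'D)
          have "(\<Sum>X\<in>UNIV. b X) = - ((\<Sum>X\<in>UNIV. f X $ D) / a)"
            by (simp add: b_def sum_negf sum_divide_distrib)
          also have "\<dots> = 0" using sum0[OF Suc.prems(2) D(1)] False by simp
          finally show "(\<Sum>X\<in>UNIV. f' X) = theta_vector \<S>"
            using Suc.prems(2) by (simp add: f'_def sum.distrib scaleR_sum_left[symmetric])
          show "f' X = 0 \<longleftrightarrow> f X = 0" if "X \<notin> \<S>" "X \<noteq> D" for X
          proof
            assume "f' X = 0"
            \<comment> \<open>The two terms of \<open>f' X\<close> cannot cancel: both have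
              nonnegative product with \<open>unit_game\<close>, and it is positive for nonzero
              \<open>f X\<close>.\<close>
            have "f X \<bullet> unit_game + b X * (f D \<bullet> unit_game) = f' X \<bullet> unit_game"
              by (simp add: f'_def inner_add_left)
            also have "\<dots> = 0" using \<open>f' X = 0\<close> by simp
            finally have "f X \<bullet> unit_game + b X * (f D \<bullet> unit_game) = 0" .
            moreover have "b X * (f D \<bullet> unit_game) \<ge> 0"
              using b[OF that(2)] exceptional_cone_inner_nonneg[OF Suc.prems(1)] by simp
            ultimately show "f X = 0"
              using exceptional_cone_pos[OF Suc.prems(1)[of X]] by (cases "f X = 0") auto
          qed (simp add: f'_def b_def)
        qed (rule f'D)
      qed
    qed
  qed
  from this[OF f sum] have "card {D. D \<notin> \<S> \<and> f D \<noteq> 0} = 0"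
    by (metis not0_implies_Suc)
  then have "{D. D \<notin> \<S> \<and> f D \<noteq> 0} = {}" by simp
  then show ?thesis using \<open>D0 \<notin> \<S>\<close> by blast
qed

section \<open>Indecomposable systems among the generators\<close>

text \<open>Farkas' lemma makes \<open>theta_vector \<S>\<close> a conic combination of
  \<open>H\<close>, up to the entry at \<open>{}\<close>. As the summands with exceptional set
  outside \<open>\<S>\<close> vanish, some \<open>h\<close> used in it is supported on
  \<open>\<S>\<close>, and uniqueness gives \<open>h = theta_vector \<S>\<close>.\<close>

lemma theta_vector_mem_generators:
  fixes H :: "(real ^ ('n::finite set)) set"
  assumes indec: "indecomposable_min_semi_balanced \<S>"
    and H: "\<And>h. h \<in> H \<Longrightarrow> (\<exists>D. h \<in> exceptional_cone D) \<and> h \<bullet> unit_game = 1"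
    and "finite H"
    and valid: "\<And>m. m $ {} = 0 \<Longrightarrow> (\<And>h. h \<in> H \<Longrightarrow> 0 \<le> h \<bullet> m) \<Longrightarrow> 0 \<le> theta_vector \<S> \<bullet> m"
  shows "theta_vector \<S> \<in> H"
proof -
  define \<theta> where "\<theta> = theta_vector \<S>"
  have msb: "min_semi_balanced \<S>"
    using indec by (simp add: indecomposable_min_semi_balanced_def purely_min_semi_balanced_def)
  obtain T where \<theta>: "\<theta> \<in> exceptional_cone T" "supp \<theta> = \<S>" "\<theta> \<bullet> unit_game = 1"
    unfolding \<theta>_def by (rule theta_vectorE[OF msb])
  let ?e = "axis {} 1 :: real ^ ('n set)"
  \<comment> \<open>\<open>s\<close> may have either sign because \<open>valid\<close> concerns only
    vectors that vanish at \<open>{}\<close>; the product with \<open>1\<close> later gives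
    \<open>s = 0\<close>.\<close>
  define Q where "Q = {y. \<exists>c s. (\<forall>h. c h \<ge> (0::real)) \<and> y = (\<Sum>h\<in>H. c h *\<^sub>R h) + s *\<^sub>R ?e}"
  have "convex_cone Q"
    unfolding convex_cone_iff
  proof (intro conjI allI impI ballI)
    show "0 \<in> Q" unfolding Q_def by (auto intro!: exI[of _ "\<lambda>_. 0"] exI[of _ 0])
  next
    fix x y assume "x \<in> Q" "y \<in> Q"
    then obtain c s d t where "\<forall>h. c h \<ge> 0" "x = (\<Sum>h\<in>H. c h *\<^sub>R h) + s *\<^sub>R ?e"
      "\<forall>h. d h \<ge> 0" "y = (\<Sum>h\<in>H. d h *\<^sub>R h) + t *\<^sub>R ?e" unfolding Q_def by blast
    then show "x + y \<in> Q" unfolding Q_def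
      by (auto intro!: exI[of _ "\<lambda>h. c h + d h"] exI[of _ "s + t"] simp: scaleR_add_left sum.distrib)
  next
    fix x and a :: real assume "x \<in> Q" "0 \<le> a"
    then obtain c s where "\<forall>h. c h \<ge> 0" "x = (\<Sum>h\<in>H. c h *\<^sub>R h) + s *\<^sub>R ?e" "0 \<le> a"
      unfolding Q_def by blast
    then show "a *\<^sub>R x \<in> Q" unfolding Q_def
      by (auto intro!: exI[of _ "\<lambda>h. a * c h"] exI[of _ "a * s"] simp: scaleR_add_right scaleR_sum_right)
  qed
  moreover have "H \<union> {?e, - ?e} \<subseteq> Q"
  proof -
    have "h \<in> Q" if "h \<in> H" for h
      unfolding Q_def using that \<open>finite H\<close>
      by (auto intro!: exI[of _ "\<lambda>g. if g = h then 1 else 0"] exI[of _ 0]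
          simp: if_distrib[where f="\<lambda>a. a *\<^sub>R _"] sum.delta cong: if_cong)
    moreover have "s *\<^sub>R ?e \<in> Q" for s
      unfolding Q_def by (auto intro!: exI[of _ "\<lambda>_. 0"])
    from this[of 1] this[of "-1"] have "?e \<in> Q" "- ?e \<in> Q" by simp_all
    ultimately show ?thesis by blast
  qed
  ultimately have hull: "convex_cone hull (H \<union> {?e, - ?e}) \<subseteq> Q"
    by (intro hull_minimal)
  have "\<theta> \<in> convex_cone hull (H \<union> {?e, - ?e})"
  proof (rule in_convex_cone_hull_if_dual)
    fix a assume a: "\<And>g. g \<in> H \<union> {?e, - ?e} \<Longrightarrow> 0 \<le> a \<bullet> g"
    have "a $ {} = 0" using a[of ?e] a[of "- ?e"] by (simp add: inner_axis)
    then have "0 \<le> \<theta> \<bullet> a"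
      unfolding \<theta>_def using a by (intro valid) (simp_all add: inner_commute)
    then show "0 \<le> a \<bullet> \<theta>" by (simp add: inner_commute)
  qed (use \<open>finite H\<close> in simp)
  then obtain c s where c: "\<And>h. c h \<ge> 0" and cs: "\<theta> = (\<Sum>h\<in>H. c h *\<^sub>R h) + s *\<^sub>R ?e"
    using hull unfolding Q_def by blast
  obtain \<delta> where \<delta>: "\<And>h. h \<in> H \<Longrightarrow> h \<in> exceptional_cone (\<delta> h)"
    using H by metis
  have "h \<bullet> 1 = 0" if "h \<in> H" for h
    using exceptional_cone_annihilators[OF \<delta>[OF that]] by (rule annihilatorsD)
  moreover have "\<theta> \<bullet> 1 = 0"
    using exceptional_cone_annihilators[OF \<theta>(1)] by (rule annihilatorsD)
  ultimately have "s = 0"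
    using arg_cong[OF cs, of "\<lambda>v. v \<bullet> 1"] by (simp add: inner_add_left inner_sum_left inner_axis')
  \<comment> \<open>The generators are grouped by a chosen exceptional set, so that each group stays
    in one cone.\<close>
  define f where "f D = (\<Sum>h\<in>{h \<in> H. \<delta> h = D}. c h *\<^sub>R h)" for D
  have f: "f D \<in> exceptional_cone D" for D
    unfolding f_def using \<delta> c by (intro exceptional_cone_sum exceptional_cone_scaleR) auto
  have sum: "(\<Sum>D\<in>UNIV. f D) = theta_vector \<S>"
    unfolding f_def \<theta>_def[symmetric] cs \<open>s = 0\<close> using \<open>finite H\<close> by (subst sum.group) auto
  have out: "f D = 0" if "D \<notin> \<S>" for D
    using indec f sum that by (rule indecomposable_sum_outside)
  have "\<exists>h\<in>H. c h \<noteq> 0"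
  proof (rule ccontr)
    assume "\<not> (\<exists>h\<in>H. c h \<noteq> 0)"
    then have "\<theta> = 0" unfolding cs \<open>s = 0\<close> by simp
    then show False using \<theta>(3) by simp
  qed
  then obtain h where h: "h \<in> H" "c h > 0" using c by (metis less_le)
  have "f (\<delta> h) \<bullet> unit_game > 0"
    unfolding f_def inner_sum_left using h c H \<open>finite H\<close> by (intro sum_pos2[where i=h]) auto
  then have "f (\<delta> h) \<noteq> 0" by auto
  then have \<delta>h: "\<delta> h \<in> \<S>" using out by blast
  \<comment> \<open>At \<open>A\<close> the group sums, and then the terms in the group of
    \<open>h\<close>, are nonpositive and add up to zero.\<close>
  have "h $ A = 0" if A: "A \<notin> \<S>" "A \<noteq> {}" "A \<noteq> UNIV" for A
  proof -
    have "A \<notin> supp \<theta>" using \<theta>(2) A by simp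
    then have "\<theta> $ A = 0" using A by (simp add: supp_def)
    then have "(\<Sum>D\<in>UNIV. f D $ A) = 0"
      using arg_cong[OF sum, of "\<lambda>v. v $ A"] by (simp add: \<theta>_def)
    moreover have "f D $ A \<le> 0" for D
      using exceptional_cone_nonpos[OF f[of D], of A] out[OF A(1)] A
      by (cases "A = D") (simp, blast)
    ultimately have "f (\<delta> h) $ A = 0"
      using sum_nonpos_eq_0_iff[of UNIV "\<lambda>D. f D $ A"] by simp
    then have "(\<Sum>g\<in>{g \<in> H. \<delta> g = \<delta> h}. c g * g $ A) = 0" by (simp add: f_def)
    moreover have "c g * g $ A \<le> 0" if "g \<in> {g \<in> H. \<delta> g = \<delta> h}" for g
    proof -
      have g: "g \<in> H" "\<delta> g = \<delta> h" using that by blast+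
      have "A \<noteq> \<delta> g" using g(2) \<delta>h A(1) by metis
      then show ?thesis
        using exceptional_cone_nonpos[OF \<delta>[OF g(1)], of A] A c[of g]
        by (simp add: mult_nonneg_nonpos)
    qed
    ultimately have "\<forall>g\<in>{g \<in> H. \<delta> g = \<delta> h}. c g * g $ A = 0"
      using \<open>finite H\<close> by (subst sum_nonpos_eq_0_iff[symmetric]) auto
    then have "c h * h $ A = 0" using h(1) by blast
    then show ?thesis using h by simp
  qed
  then have "supp h \<subseteq> \<S>" unfolding supp_def by blast
  then have "theta_vector \<S> = h"
    using theta_vector_eqI[OF msb \<delta>[OF h(1)]] H[OF h(1)] by blast
  then show ?thesis using h(1) by simp
qed

theorem theorem18:
  fixes \<theta> :: "real ^ ('n::finite set)"
  assumes "CARD('n) \<ge> 3"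
    and "(\<Sum>S\<in>UNIV. \<theta> $ S) = 0"
    and "(\<Sum>L | L \<noteq> {} \<and> L \<subset> UNIV. \<theta> $ L) = -1"
  shows "facet_defining \<theta> (exact_cone :: (real ^ ('n set)) set) \<longleftrightarrow>
         (\<exists>\<S> :: 'n set set. indecomposable_min_semi_balanced \<S> \<and> \<theta> = theta_vector \<S>)"
proof -
  define G :: "(real ^ ('n set)) set" where "G = theta_vector ` {\<S>. min_semi_balanced \<S>}"
  define L :: "(real ^ ('n set)) set" where "L = {m. m $ {} = 0}"
  have G: "(\<exists>D. g \<in> exceptional_cone D) \<and> g \<bullet> unit_game = 1" if g: "g \<in> G" for g
  proof -
    obtain \<S> where "min_semi_balanced \<S>" "g = theta_vector \<S>"
      using g unfolding G_def by blast
    then show ?thesis using theta_vectorE[of \<S>] by blast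
  qed
  have finG: "finite G" unfolding G_def by simp
  have subL: "subspace L" by (auto simp: L_def subspace_def)
  have uL: "unit_game \<in> L" by (simp add: L_def unit_game_def)
  have Gu: "0 < g \<bullet> unit_game" if "g \<in> G" for g using G[OF that] by simp
  have K: "exact_cone = {m \<in> L. \<forall>g\<in>G. 0 \<le> g \<bullet> m}"
    unfolding exact_cone_eq G_def L_def by blast
  have uK: "unit_game \<in> (exact_cone :: (real ^ ('n set)) set)"
    unfolding K using uL Gu by (simp add: less_imp_le)
  have hullK: "affine hull exact_cone = L"
    unfolding K using finG subL uL Gu by (rule affine_hull_dual_cone)
  obtain H where H: "H \<subseteq> G" "exact_cone = {m \<in> L. \<forall>h\<in>H. 0 \<le> h \<bullet> m}"
    and facets: "\<And>C. C facet_of exact_cone \<longleftrightarrow> (\<exists>h\<in>H. C = {m \<in> exact_cone. h \<bullet> m = 0})"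
    using facets_of_dual_cone[OF finG subL uL Gu K] by blast
  have ones: "\<theta> \<bullet> 1 = 0"
    using assms(2) by (simp add: inner_vec_def)
  have unit: "\<theta> \<bullet> unit_game = 1"
  proof -
    have eq: "{L. L \<noteq> {} \<and> L \<subset> UNIV} = {L::'n set. L \<noteq> {} \<and> L \<noteq> UNIV}" by blast
    have "\<theta> \<bullet> unit_game = - (\<Sum>L | L \<noteq> {} \<and> L \<noteq> UNIV. \<theta> $ L)"
      by (rule unit_game_inner) (auto simp: supp_def)
    then show ?thesis using assms(3) by (simp add: eq)
  qed
  \<comment> \<open>On \<open>L\<close> the facet normal is unique up to scaling. Both vectors
    annihilate \<open>1\<close>, which together with \<open>L\<close> spans the whole space, so the
    equality also holds at \<open>{}\<close>.\<close>
  have unique: "\<phi> = (\<phi> \<bullet> unit_game) *\<^sub>R \<theta>"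
    if facet: "{m \<in> exact_cone. \<theta> \<bullet> m = 0} facet_of exact_cone"
      and \<phi>: "\<phi> \<bullet> 1 = 0" "\<And>m. m \<in> exact_cone \<Longrightarrow> \<theta> \<bullet> m = 0 \<Longrightarrow> \<phi> \<bullet> m = 0" for \<phi>
  proof -
    have on_L: "\<phi> \<bullet> m = (\<phi> \<bullet> unit_game) * (\<theta> \<bullet> m)" if "m \<in> L" for m
    proof -
      have "\<theta> \<bullet> unit_game > 0" using unit by simp
      from facet_normal_unique[OF facet uK this \<phi>(2), of m] show ?thesis
        unfolding unit hullK using that by simp
    qed
    have "\<phi> \<bullet> m = ((\<phi> \<bullet> unit_game) *\<^sub>R \<theta>) \<bullet> m" for m
    proof -
      have "m - (m $ {}) *\<^sub>R 1 \<in> L" by (simp add: L_def)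
      from on_L[OF this] show ?thesis using \<phi>(1) ones by (simp add: inner_diff_right)
    qed
    then show ?thesis using vector_eq_rdot by blast
  qed
  show ?thesis
  proof
    assume fd: "facet_defining \<theta> (exact_cone :: (real ^ ('n set)) set)"
    then have facet: "{m \<in> exact_cone. \<theta> \<bullet> m = 0} facet_of exact_cone"
      by (simp add: facet_defining_def)
    then obtain h where h: "h \<in> H" "{m \<in> exact_cone. \<theta> \<bullet> m = 0} = {m \<in> exact_cone. h \<bullet> m = 0}"
      unfolding facets by blast
    have hG: "h \<in> G" using h(1) H(1) by blast
    then obtain \<S> where \<S>: "min_semi_balanced \<S>" "h = theta_vector \<S>" unfolding G_def by blast
    have "h \<bullet> 1 = 0"
      using G[OF hG] exceptional_cone_annihilators annihilatorsD(1) by blast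
    then have "h = (h \<bullet> unit_game) *\<^sub>R \<theta>"
      using h(2) by (intro unique[OF facet]) auto
    then have \<theta>: "\<theta> = theta_vector \<S>" using G[OF hG] \<S>(2) by simp
    have "indecomposable_min_semi_balanced \<S>"
    proof (rule indecomposable_if_extremal[OF assms(1) \<S>(1)])
      fix \<theta>1 \<theta>2 D1 D2
      assume mem: "\<theta>1 \<in> exceptional_cone D1" "\<theta>2 \<in> exceptional_cone D2"
        and sum: "\<theta>1 + \<theta>2 = theta_vector \<S>"
      \<comment> \<open>Both summands are nonnegative on the exact cone, so they vanish on the
        facet, where their sum does.\<close>
      have "\<theta>1 \<bullet> m = 0" if m: "m \<in> exact_cone" "\<theta> \<bullet> m = 0" for m
      proof -
        have "0 \<le> \<theta>1 \<bullet> m" "0 \<le> \<theta>2 \<bullet> m"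
          using m(1) mem unfolding exact_cone_def exact_game_iff by blast+
        moreover have "\<theta>1 \<bullet> m + \<theta>2 \<bullet> m = 0"
          using m(2) sum by (simp add: \<theta> inner_add_left[symmetric])
        ultimately show ?thesis by linarith
      qed
      moreover have "\<theta>1 \<bullet> 1 = 0"
        using exceptional_cone_annihilators[OF mem(1)] by (rule annihilatorsD)
      ultimately have "\<theta>1 = (\<theta>1 \<bullet> unit_game) *\<^sub>R \<theta>" by (intro unique[OF facet])
      then show "\<exists>c. \<theta>1 = c *\<^sub>R theta_vector \<S>" using \<theta> by blast
    qed
    then show "\<exists>\<S>. indecomposable_min_semi_balanced \<S> \<and> \<theta> = theta_vector \<S>"
      using \<theta> by blast
  next
    assume "\<exists>\<S>. indecomposable_min_semi_balanced \<S> \<and> \<theta> = theta_vector \<S>"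
    then obtain \<S> where \<S>: "indecomposable_min_semi_balanced \<S>" and \<theta>: "\<theta> = theta_vector \<S>" by blast
    have msb: "min_semi_balanced \<S>"
      using \<S> by (simp add: indecomposable_min_semi_balanced_def purely_min_semi_balanced_def)
    have valid: "0 \<le> \<theta> \<bullet> m" if "m \<in> exact_cone" for m
      using that msb unfolding exact_cone_eq \<theta> by blast
    \<comment> \<open>Every member of the irredundant set \<open>H\<close> defines a facet, so
      membership suffices.\<close>
    have "theta_vector \<S> \<in> H"
    proof (rule theta_vector_mem_generators[OF \<S>])
      show "finite H" using H(1) finG by (rule finite_subset)
      show "0 \<le> theta_vector \<S> \<bullet> m" if "m $ {} = 0" "\<And>h. h \<in> H \<Longrightarrow> 0 \<le> h \<bullet> m" for m
        using valid[of m] that unfolding H(2) \<theta> L_def by blast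
    qed (use G H(1) in blast)
    then have "{m \<in> exact_cone. \<theta> \<bullet> m = 0} facet_of exact_cone"
      unfolding facets \<theta> by blast
    then show "facet_defining \<theta> (exact_cone :: (real ^ ('n set)) set)"
      using valid by (simp add: facet_defining_def)
  qed
qed

end
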